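(* Let $K$ be a number field and $\mathfrak{p}$ a nonzero prime ideal of $\mathcal{O}_K$. The arithmetic partial derivative $D_{K,\mathfrak{p}}$ is $\mathfrak{p}$-adically continuous at every point of $K$.
   Context: For a nonzero prime ideal $\mathfrak{q}$ of the ring of integers of a number field lying over the rational prime $q$, $\nu_{\mathfrak{q}}$ denotes the associated discrete valuation normalized to extend $\nu_q$ (so $\nu_{\mathfrak{q}}(q)=1$), and for a finite Galois extension $L/\mathbb{Q}$, $g(q,L)$ is the number of prime ideals of $\mathcal{O}_L$ over $q$. For $L/\mathbb{Q}$ finite Galois and a set $T'$ of nonzero prime ideals of $\mathcal{O}_L$, define $D_{L,T'}(0)=0$ and for $x\neq0$, $D_{L,T'}(x) := x\sum_{\mathfrak{Q}\in T'} \frac{\nu_{\mathfrak{Q}}(x)}{q\,g(q,L)}$, where $q$ is the rational prime below $\mathfrak{Q}$ (only finitely many terms are nonzero). For an arbitrary number field $K$ and a set $T$ of nonzero prime ideals of $\mathcal{O}_K$, choose a finite extension $L/K$ with $L/\mathbb{Q}$ Galois, let $T_{L/K}$ be the set of prime ideals of $\mathcal{O}_L$ lying over some element of $T$, and set $D_{K,T}(x) := D_{L,T_{L/K}}(x)$ for $x\in K$ (this is independent of $L$). The arithmetic partial derivative is $D_{K,\mathfrak{p}} := D_{K,\{\mathfrak{p}\}}$. $K$ carries the ultrametric absolute value $|x|_{\nu_{\mathfrak{p}}} = c^{\nu_{\mathfrak{p}}(x)}$ (for some fixed $0<c<1$), which defines the $\mathfrak{p}$-adic topology. *)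

theory Defs
  imports
    "HOL-Analysis.Analysis"
    "HOL-Computational_Algebra.Computational_Algebra"
    "HOL-Algebra.Embedded_Algebras"
    "HOL-Algebra.Ideal_Product"
    "HOL-Algebra.Algebraic_Closure_Type"
begin

text \<open>
  Number fields are subfields of finite degree over the rationals of an arbitrary algebraically
  closed field of characteristic 0, given as a type; every number field embeds into such a field.
\<close>

definition number_field :: "'a::{alg_closed_field, field_char_0} set \<Rightarrow> bool" where
  "number_field K \<longleftrightarrow>
     subfield K ring_of_type_algebra \<and> ring.finite_dimension ring_of_type_algebra \<rat> K"

definition ring_of_integers :: "'a::{alg_closed_field, field_char_0} set \<Rightarrow> 'a ring" where
  "ring_of_integers K = ring_of_type_algebra\<lparr>carrier := {x \<in> K. algebraic_int x}\<rparr>"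

definition nonzero_primes :: "'a::{alg_closed_field, field_char_0} set \<Rightarrow> 'a set set" where
  "nonzero_primes K = {P. primeideal P (ring_of_integers K) \<and> P \<noteq> {0}}"

definition prime_below :: "'a::{alg_closed_field, field_char_0} set \<Rightarrow> nat" where
  "prime_below P = (THE q. Factorial_Ring.prime q \<and> of_nat q \<in> P)"

definition num_primes_over :: "nat \<Rightarrow> 'a::{alg_closed_field, field_char_0} set \<Rightarrow> nat" where
  "num_primes_over q L = card {Q \<in> nonzero_primes L. prime_below Q = q}"

text \<open>
  The exponent of \<open>P\<close> in the factorization of the principal ideal generated by a nonzero
  integer \<open>a\<close> is the largest \<open>n\<close> such that the \<open>n\<close>-th ideal power of \<open>P\<close> contains \<open>a\<close>.
  It extends to nonzero elements of the field by writing them as quotients of integers.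
\<close>

definition int_ord :: "'a::{alg_closed_field, field_char_0} set \<Rightarrow> 'a set \<Rightarrow> 'a \<Rightarrow> nat" where
  "int_ord K P a = (GREATEST n. a \<in> P [^]\<^bsub>ideals_set (ring_of_integers K)\<^esub> n)"

definition field_ord :: "'a::{alg_closed_field, field_char_0} set \<Rightarrow> 'a set \<Rightarrow> 'a \<Rightarrow> int" where
  "field_ord K P x =
     (THE k. \<exists>a \<in> carrier (ring_of_integers K) - {0}. \<exists>b \<in> carrier (ring_of_integers K) - {0}.
        x = a / b \<and> k = int (int_ord K P a) - int (int_ord K P b))"

text \<open>
  The valuation with value 1 at the rational prime below \<open>P\<close>. Only its values at nonzero
  arguments are meaningful; the value at 0, which should be infinite, is never used.
\<close>

definition valuation :: "'a::{alg_closed_field, field_char_0} set \<Rightarrow> 'a set \<Rightarrow> 'a \<Rightarrow> rat" where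
  "valuation K P x = of_int (field_ord K P x) / of_int (field_ord K P (of_nat (prime_below P)))"

text \<open>
  Galois over the rationals, i.e. normal and separable: every irreducible rational polynomial
  with a root in \<open>L\<close> is a product of distinct linear factors over \<open>L\<close>.
\<close>

definition galois_number_field :: "'a::{alg_closed_field, field_char_0} set \<Rightarrow> bool" where
  "galois_number_field L \<longleftrightarrow> number_field L \<and>
     (\<forall>p :: rat poly. Factorial_Ring.irreducible p \<and> (\<exists>x\<in>L. poly (map_poly of_rat p) x = 0) \<longrightarrow>
        (\<exists>A. finite A \<and> A \<subseteq> L \<and>
           map_poly of_rat p = Polynomial.smult (of_rat (Polynomial.lead_coeff p)) (\<Prod>a\<in>A. [:- a, 1:])))"

text \<open>
  The sum ranges over its finitely many nonzero terms, since \<open>T\<close> may be infinite.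
\<close>

definition arith_deriv_galois ::
    "'a::{alg_closed_field, field_char_0} set \<Rightarrow> 'a set set \<Rightarrow> 'a \<Rightarrow> 'a" where
  "arith_deriv_galois L T x =
     (if x = 0 then 0
      else x * of_rat (\<Sum>Q\<in>{Q \<in> T. valuation L Q x \<noteq> 0}.
             valuation L Q x / of_nat (prime_below Q * num_primes_over (prime_below Q) L)))"

definition primes_over ::
    "'a::{alg_closed_field, field_char_0} set \<Rightarrow> 'a set \<Rightarrow> 'a set set \<Rightarrow> 'a set set" where
  "primes_over L K T =
     {Q \<in> nonzero_primes L. Q \<inter> carrier (ring_of_integers K) \<in> T}"

definition galois_extension :: "'a::{alg_closed_field, field_char_0} set \<Rightarrow> 'a set" where
  "galois_extension K = (SOME L. K \<subseteq> L \<and> galois_number_field L)"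

definition arith_deriv ::
    "'a::{alg_closed_field, field_char_0} set \<Rightarrow> 'a set set \<Rightarrow> 'a \<Rightarrow> 'a" where
  "arith_deriv K T x =
     arith_deriv_galois (galois_extension K) (primes_over (galois_extension K) K T) x"

definition arith_partial_deriv ::
    "'a::{alg_closed_field, field_char_0} set \<Rightarrow> 'a set \<Rightarrow> 'a \<Rightarrow> 'a" where
  "arith_partial_deriv K P = arith_deriv K {P}"

definition padic_abs ::
    "real \<Rightarrow> 'a::{alg_closed_field, field_char_0} set \<Rightarrow> 'a set \<Rightarrow> 'a \<Rightarrow> real" where
  "padic_abs c K P x = (if x = 0 then 0 else c powr real_of_rat (valuation K P x))"

definition padic_topology ::
    "real \<Rightarrow> 'a::{alg_closed_field, field_char_0} set \<Rightarrow> 'a set \<Rightarrow> 'a topology" where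
  "padic_topology c K P = Metric_space.mtopology K (\<lambda>x y. padic_abs c K P (x - y))"

end

theory Submission
  imports Defs "Jordan_Normal_Form.Char_Poly"
begin

text \<open>
  For \<open>x\<close> in \<open>K\<close>, every prime \<open>Q\<close> over \<open>P\<close> in a Galois extension satisfies \<open>\<nu>\<^sub>Q x = \<nu>\<^sub>P x\<close>, so the
  partial derivative is \<open>x \<mapsto> r x \<nu>\<^sub>P(x)\<close> for a rational constant \<open>r\<close>. Away from 0 it is
  locally linear, because \<open>\<nu>\<^sub>P\<close> is locally constant there. At 0 it is Lipschitz: the values of \<open>\<nu>\<^sub>P\<close>
  are integers divided by the ramification index, and integers have absolute value at most 1.

  That \<open>\<nu>\<^sub>P\<close>, defined through powers of the ideal \<open>P\<close>, is a valuation rests on an element \<open>\<gamma>\<close> of \<open>K\<close>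
  with \<open>\<gamma> P \<subseteq> \<O>\<close> and \<open>\<gamma> P\<close> not contained in \<open>P\<close>: it gives \<open>a \<in> P\<^sup>n\<close> if and only if \<open>\<gamma>\<^sup>n a \<in> \<O>\<close>.
\<close>

hide_const (open) Polynomials.lead_coeff Polynomials.degree up_ring.coeff up_ring.monom

section \<open>Algebraic integers\<close>

interpretation int_module: Modules.module "\<lambda>(n::int) (x::'a::comm_ring_1). of_int n * x"
  by unfold_locales (simp_all add: algebra_simps)

lemma int_span_mult:
  fixes t :: "'a::comm_ring_1"
  assumes "y \<in> int_module.span S" "\<And>s. s \<in> S \<Longrightarrow> s * t \<in> int_module.span T"
  shows "y * t \<in> int_module.span T"
  using assms(1)
proof (induction rule: int_module.span_induct_alt)
  case base
  then show ?case by (simp add: int_module.span_zero)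
next
  case (step c x y)
  have "of_int c * (x * t) + y * t \<in> int_module.span T"
    using step assms(2) by (intro int_module.span_add int_module.span_scale)
  then show ?case by (simp add: algebra_simps)
qed

lemma algebraic_int_if_stable_int_span:
  fixes x :: "'a::field_char_0"
  assumes "finite S" "s0 \<in> S" "s0 \<noteq> 0"
    and stable: "\<And>s. s \<in> S \<Longrightarrow> x * s \<in> int_module.span S"
  shows "algebraic_int x"
proof -
  have "\<forall>s\<in>S. \<exists>c::'a \<Rightarrow> int. x * s = (\<Sum>t\<in>S. of_int (c t) * t)"
    using stable unfolding int_module.span_finite[OF assms(1)] by blast
  then obtain c :: "'a \<Rightarrow> 'a \<Rightarrow> int"
    where c: "\<And>s. s \<in> S \<Longrightarrow> x * s = (\<Sum>t\<in>S. of_int (c s t) * t)"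
    by metis
  obtain xs where xs: "set xs = S" "distinct xs"
    using finite_distinct_list[OF assms(1)] by blast
  define n where "n = length xs"
  define M where "M = mat n n (\<lambda>(i, j). c (xs ! i) (xs ! j))"
  define v where "v = vec n (\<lambda>i. xs ! i)"
  have M: "M \<in> carrier_mat n n" by (simp add: M_def)
  have sum_nth: "(\<Sum>t\<in>S. f t) = (\<Sum>j = 0..<n. f (xs ! j))" for f :: "'a \<Rightarrow> 'a"
    using sum.reindex_bij_betw[OF bij_betw_nth[OF xs(2) refl refl], of f]
    by (simp add: xs(1) n_def atLeast0LessThan)
  have "map_mat of_int M *\<^sub>v v = x \<cdot>\<^sub>v v"
  proof (rule eq_vecI)
    fix i assume "i < dim_vec (x \<cdot>\<^sub>v v)"
    then have i: "i < n" by (simp add: v_def)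
    then have "xs ! i \<in> S" using xs(1) by (auto simp: n_def)
    then show "(map_mat of_int M *\<^sub>v v) $ i = (x \<cdot>\<^sub>v v) $ i"
      using i c by (simp add: M_def v_def scalar_prod_def sum_nth)
  qed (simp add: M_def v_def)
  moreover have "v \<noteq> 0\<^sub>v n"
  proof
    assume v0: "v = 0\<^sub>v n"
    obtain i where i: "i < n" "xs ! i = s0"
      using assms(2) xs(1) by (metis in_set_conv_nth n_def)
    have "v $ i = 0" using i by (simp add: v0)
    then show False using i assms(3) by (simp add: v_def)
  qed
  ultimately have "eigenvalue (map_mat of_int M) x"
    unfolding eigenvalue_def eigenvector_def by (intro exI[of _ v]) (auto simp: v_def M_def)
  then have "poly (char_poly (map_mat of_int M)) x = 0"
    using eigenvalue_root_char_poly[of "map_mat of_int M" n x] M by simp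
  then have "poly (map_poly of_int (char_poly M)) x = 0"
    by (simp add: of_int_hom.char_poly_hom[OF M])
  moreover have "lead_coeff (char_poly M) = 1"
    using degree_monic_char_poly[OF M] by simp
  ultimately show ?thesis
    unfolding algebraic_int_altdef_ipoly by blast
qed

lemma algebraic_ints_stabilize_int_span:
  fixes A :: "'a::field_char_0 set"
  assumes "finite A" "\<And>a. a \<in> A \<Longrightarrow> algebraic_int a"
  shows "\<exists>S. finite S \<and> 1 \<in> S \<and> (\<forall>a\<in>A. \<forall>s\<in>S. a * s \<in> int_module.span S)"
  using assms
proof (induction rule: finite_induct)
  case empty
  show ?case by (intro exI[of _ "{1}"]) auto
next
  case (insert a A)
  then obtain S where S: "finite S" "1 \<in> S"
    and stable: "\<And>b s. b \<in> A \<Longrightarrow> s \<in> S \<Longrightarrow> b * s \<in> int_module.span S" by blast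
  obtain p where p: "poly (map_poly of_int p) a = 0" "lead_coeff p = (1::int)"
    using insert.prems[of a] unfolding algebraic_int_altdef_ipoly by auto
  define d where "d = degree p"
  have pa: "(\<Sum>k\<le>d. of_int (coeff p k) * a ^ k) = 0"
    using p(1) by (simp add: poly_altdef d_def)
  have d: "d > 0"
  proof (rule ccontr)
    assume "\<not> d > 0"
    then have "d = 0" by simp
    then show False using pa p(2) by (simp add: d_def)
  qed
  have ad: "a ^ d = (\<Sum>k<d. of_int (- coeff p k) * a ^ k)"
  proof -
    have "(\<Sum>k<d. of_int (coeff p k) * a ^ k) + a ^ d = 0"
      using pa p(2) by (simp add: lessThan_Suc_atMost[symmetric] d_def)
    then show ?thesis by (simp add: sum_negf eq_neg_iff_add_eq_0 add.commute)
  qed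
  define T where "T = (\<lambda>(s, i). s * a ^ i) ` (S \<times> {..<d})"
  have base: "s * a ^ i \<in> int_module.span T" if "s \<in> S" "i < d" for s i
    using that by (intro int_module.span_base) (auto simp: T_def)
  have "b * t \<in> int_module.span T" if b: "b \<in> insert a A" and t: "t \<in> T" for b t
  proof -
    obtain s i where s: "s \<in> S" "i < d" "t = s * a ^ i" using t by (auto simp: T_def)
    consider "b \<in> A" | "b = a" "Suc i < d" | "b = a" "Suc i = d"
      using b s by (metis Suc_lessI insertE)
    then show ?thesis
    proof cases
      case 1
      have "(b * s) * a ^ i \<in> int_module.span T"
        by (rule int_span_mult[OF stable]) (use 1 s base in auto)
      then show ?thesis by (simp add: s mult.assoc)
    next
      case 2
      then show ?thesis using base[OF s(1), of "Suc i"] by (simp add: s algebra_simps)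
    next
      case 3
      have "b * t = s * a ^ d"
        using 3 s by (simp flip: 3(2))
      also have "\<dots> = (\<Sum>k<d. of_int (- coeff p k) * (s * a ^ k))"
        unfolding ad sum_distrib_left by (intro sum.cong) (auto simp: algebra_simps)
      also have "\<dots> \<in> int_module.span T"
        by (intro int_module.span_sum int_module.span_scale base) (use s in auto)
      finally show ?thesis .
    qed
  qed
  moreover have "finite T" using S by (simp add: T_def)
  moreover have "1 \<in> T" unfolding T_def by (rule image_eqI[of _ _ "(1, 0)"]) (use S d in auto)
  ultimately show ?case by blast
qed

lemma
  fixes x y :: "'a::field_char_0"
  assumes "algebraic_int x" "algebraic_int y"
  shows algebraic_int_plus: "algebraic_int (x + y)"
    and algebraic_int_times: "algebraic_int (x * y)"
proof -
  obtain S where S: "finite S" "1 \<in> S"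
    and st: "\<And>s. s \<in> S \<Longrightarrow> x * s \<in> int_module.span S" "\<And>s. s \<in> S \<Longrightarrow> y * s \<in> int_module.span S"
    using algebraic_ints_stabilize_int_span[of "{x, y}"] assms by (metis finite.emptyI finite.insertI insert_iff empty_iff)
  have "(x + y) * s \<in> int_module.span S" if "s \<in> S" for s
    using int_module.span_add[OF st(1)[OF that] st(2)[OF that]] by (simp add: algebra_simps)
  then show "algebraic_int (x + y)"
    by (intro algebraic_int_if_stable_int_span[OF S]) auto
  have "(y * s) * x \<in> int_module.span S" if "s \<in> S" for s
    by (rule int_span_mult[OF st(2)[OF that]]) (use st in \<open>simp add: mult.commute\<close>)
  then show "algebraic_int (x * y)"
    by (intro algebraic_int_if_stable_int_span[OF S]) (auto simp: algebra_simps)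
qed

lemma algebraic_int_if_stable_module:
  fixes x :: "'a::field_char_0"
  assumes "finite V" "v0 \<in> V" "v0 \<noteq> 0"
    and eq: "\<And>v. v \<in> V \<Longrightarrow> x * v = (\<Sum>w\<in>V. a v w * w)"
    and int: "\<And>v w. v \<in> V \<Longrightarrow> w \<in> V \<Longrightarrow> algebraic_int (a v w)"
  shows "algebraic_int x"
proof -
  define A where "A = (\<lambda>(v, w). a v w) ` (V \<times> V)"
  obtain S where S: "finite S" "1 \<in> S" "\<And>c s. c \<in> A \<Longrightarrow> s \<in> S \<Longrightarrow> c * s \<in> int_module.span S"
  proof -
    have "finite A" "\<And>c. c \<in> A \<Longrightarrow> algebraic_int c" using assms(1) int by (auto simp: A_def)
    then show ?thesis using algebraic_ints_stabilize_int_span[of A] that by blast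
  qed
  define T where "T = (\<lambda>(s, v). s * v) ` (S \<times> V)"
  show ?thesis
  proof (rule algebraic_int_if_stable_int_span)
    show "finite T" using S assms by (simp add: T_def)
    show "v0 \<in> T" unfolding T_def by (rule image_eqI[of _ _ "(1, v0)"]) (use S assms in auto)
    show "x * t \<in> int_module.span T" if t: "t \<in> T" for t
    proof -
      obtain s v where s: "s \<in> S" "v \<in> V" "t = s * v" using t by (auto simp: T_def)
      have "x * t = (\<Sum>w\<in>V. (a v w * s) * w)"
        using eq[OF s(2)] s(3) by (simp add: sum_distrib_left mult_ac)
      also have "\<dots> \<in> int_module.span T"
      proof (intro int_module.span_sum)
        fix w assume w: "w \<in> V"
        have "a v w \<in> A" using s w by (force simp: A_def)
        then show "(a v w * s) * w \<in> int_module.span T"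
          by (intro int_span_mult[OF S(3)] int_module.span_base) (use s w in \<open>auto simp: T_def\<close>)
      qed
      finally show ?thesis .
    qed
  qed (use assms in auto)
qed

section \<open>Number fields and their rings of integers\<close>

interpretation rat_space: vector_space "\<lambda>(r::rat) (x::'a::field_char_0). of_rat r * x"
  by unfold_locales (simp_all add: algebra_simps of_rat_add of_rat_mult)

lemma ring_of_type_algebra_simps [simp]:
  "carrier ring_of_type_algebra = UNIV"
  "x \<otimes>\<^bsub>ring_of_type_algebra\<^esub> y = x * y"
  "x \<oplus>\<^bsub>ring_of_type_algebra\<^esub> y = x + y"
  "\<zero>\<^bsub>ring_of_type_algebra\<^esub> = 0"
  "\<one>\<^bsub>ring_of_type_algebra\<^esub> = 1"
  by (simp_all add: ring_of_type_algebra_def)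

interpretation type_ring: domain "ring_of_type_algebra :: 'a::Fields.field ring"
  by (rule field.axioms(1)[OF field_from_type_algebra])

lemma type_ring_a_inv [simp]: "\<ominus>\<^bsub>ring_of_type_algebra\<^esub> x = - (x::'a::Fields.field)"
  using type_ring.r_neg[of x] by (simp add: eq_neg_iff_add_eq_0 add.commute)

lemma type_ring_m_inv [simp]:
  "x \<noteq> 0 \<Longrightarrow> inv\<^bsub>ring_of_type_algebra\<^esub> x = inverse (x::'a::Fields.field)"
  using type_ring.Units_r_inv[of x] field.field_Units[OF field_from_type_algebra]
  by (metis (no_types, opaque_lifting) Diff_iff UNIV_I inverse_unique
      ring_of_type_algebra_simps(1,2,4,5) singletonD)

lemma subfield_closed:
  fixes K :: "'a::Fields.field set"
  assumes "subfield K ring_of_type_algebra"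
  shows "0 \<in> K" "1 \<in> K"
    and "\<And>x y. x \<in> K \<Longrightarrow> y \<in> K \<Longrightarrow> x + y \<in> K"
    and "\<And>x y. x \<in> K \<Longrightarrow> y \<in> K \<Longrightarrow> x * y \<in> K"
    and "\<And>x. x \<in> K \<Longrightarrow> - x \<in> K"
    and "\<And>x. x \<in> K \<Longrightarrow> inverse x \<in> K"
proof -
  note sr = subringE[OF subfieldE(1)[OF assms], simplified]
  show "0 \<in> K" "1 \<in> K" using sr by auto
  show "x + y \<in> K" "x * y \<in> K" if "x \<in> K" "y \<in> K" for x y using sr that by auto
  show "- x \<in> K" if "x \<in> K" for x using sr that by auto
  show "inverse x \<in> K" if "x \<in> K" for x
    using type_ring.subfield_m_inv(1)[OF assms, of x] that by (cases "x = 0") auto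
qed

lemma finite_dimension_rat_span:
  fixes E :: "'a::field_char_0 set"
  assumes "ring.finite_dimension ring_of_type_algebra \<rat> E"
  obtains B where "finite B" "B \<subseteq> E" "E \<subseteq> rat_space.span B"
proof -
  obtain n where "ring.dimension ring_of_type_algebra n \<rat> E"
    using assms type_ring.finite_dimension_def over_def by metis
  then have "0 \<in> E \<and> (\<exists>B. finite B \<and> B \<subseteq> E \<and> E \<subseteq> rat_space.span B)"
  proof (induction n "\<rat> :: 'a set" E rule: type_ring.dimension.induct)
    case zero_dim
    then show ?case by (intro conjI exI[of _ "{}"]) auto
  next
    case (Suc_dim v E n)
    then obtain B where B: "finite B" "B \<subseteq> E" "E \<subseteq> rat_space.span B" and "0 \<in> E" by blast
    have "k * v + w \<in> type_ring.line_extension \<rat> v E" if "k \<in> \<rat>" "w \<in> E" for k w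
      using that by (auto simp: type_ring.line_extension_mem_iff)
    from this[of 0] this[OF _ \<open>0 \<in> E\<close>, of 1]
    have "E \<subseteq> type_ring.line_extension \<rat> v E" "v \<in> type_ring.line_extension \<rat> v E"
      by auto
    moreover have "x \<in> rat_space.span (insert v B)" if x: "x \<in> type_ring.line_extension \<rat> v E" for x
    proof -
      obtain k w where k: "k \<in> \<rat>" "w \<in> E" "x = k * v + w"
        using x by (auto simp: type_ring.line_extension_mem_iff)
      then obtain r where r: "k = of_rat r" by (auto elim: Rats_cases)
      have "w \<in> rat_space.span (insert v B)"
        using k B(3) rat_space.span_mono[of B "insert v B"] by auto
      then show ?thesis
        unfolding k r using rat_space.span_base[of v "insert v B"]
        by (intro rat_space.span_add rat_space.span_scale) auto
    qed
    ultimately show ?case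
      using B(1,2) \<open>0 \<in> E\<close> by (intro conjI exI[of _ "insert v B"]) auto
  qed
  then show ?thesis using that by blast
qed

lemma clear_denominators:
  fixes u :: "'b \<Rightarrow> rat"
  assumes "finite S"
  shows "\<exists>d::int. d \<noteq> 0 \<and> (\<forall>s\<in>S. of_int d * u s \<in> \<int>)"
  using assms
proof (induction rule: finite_induct)
  case (insert s S)
  then obtain d :: int where d: "d \<noteq> 0" "\<And>s. s \<in> S \<Longrightarrow> of_int d * u s \<in> \<int>" by blast
  obtain a b :: int where ab: "u s = of_int a / of_int b" "b \<noteq> 0"
    by (metis Fract_of_int_quotient Rat_cases less_irrefl)
  have "of_int (d * b) * u t \<in> \<int>" if "t \<in> insert s S" for t
  proof (cases "t = s")
    case True
    then show ?thesis using ab by simp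
  next
    case False
    then have "t \<in> S" using that by simp
    then have "of_int b * (of_int d * u t) \<in> \<int>" by (rule Ints_mult[OF Ints_of_int d(2)])
    moreover have "of_int (d * b) * u t = of_int b * (of_int d * u t)" by simp
    ultimately show ?thesis by metis
  qed
  then show ?case using d ab by (intro exI[of _ "d * b"]) auto
qed (auto intro: exI[of _ 1])

lemma algebraic_int_multiple:
  fixes x :: "'a::field_char_0"
  assumes "algebraic x"
  obtains m :: int where "m \<noteq> 0" "algebraic_int (of_int m * x)"
proof -
  obtain p where p: "p \<noteq> 0" "poly (map_poly of_int p) x = 0"
    using assms by (rule algebraicE')
  define d where "d = degree p"
  define a where "a = lead_coeff p"
  have a: "a \<noteq> 0" using p by (simp add: a_def)
  have px: "(\<Sum>k\<le>d. of_int (coeff p k) * x ^ k) = 0"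
    using p(2) by (simp add: poly_altdef d_def)
  have d: "d > 0"
  proof (rule ccontr)
    assume "\<not> d > 0"
    then have "d = 0" by simp
    then show False using px a by (simp add: a_def d_def)
  qed
  define c where "c k = (if k = d then 1 else coeff p k * a ^ (d - 1 - k))" for k
  define q where "q = (\<Sum>k\<le>d. monom (c k) k)"
  have coeff_q: "coeff q k = (if k \<le> d then c k else 0)" for k
    by (simp add: q_def coeff_sum)
  have "degree q \<le> d" by (rule degree_le) (simp add: coeff_q)
  moreover have "degree q \<ge> d" by (rule le_degree) (simp add: coeff_q c_def)
  ultimately have deg: "degree q = d" by simp
  have "poly (map_poly of_int q) (of_int a * x) = (\<Sum>k\<le>d. of_int (c k) * (of_int a * x) ^ k)"
    by (simp add: poly_altdef deg coeff_q)
  also have "\<dots> = (\<Sum>k\<le>d. of_int a ^ (d - 1) * (of_int (coeff p k) * x ^ k))"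
  proof (rule sum.cong)
    fix k assume "k \<in> {..d}"
    show "of_int (c k) * (of_int a * x) ^ k = of_int a ^ (d - 1) * (of_int (coeff p k) * x ^ k)"
    proof (cases "k = d")
      case True
      have "of_int a ^ d = (of_int a ^ (d - 1) * of_int a :: 'a)"
        using d by (metis One_nat_def Suc_pred power_Suc2)
      then show ?thesis using True by (simp add: c_def power_mult_distrib a_def d_def)
    next
      case False
      then have "d - 1 = (d - 1 - k) + k" using \<open>k \<in> {..d}\<close> by auto
      then have "of_int a ^ (d - 1) = (of_int a ^ (d - 1 - k) * of_int a ^ k :: 'a)"
        by (metis power_add)
      then show ?thesis using False by (simp add: c_def power_mult_distrib)
    qed
  qed simp
  also have "\<dots> = 0" unfolding sum_distrib_left[symmetric] px by simp
  finally have "algebraic_int (of_int a * x)"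
    unfolding algebraic_int_altdef_ipoly by (intro exI[of _ q]) (simp add: deg coeff_q c_def)
  then show ?thesis using that a by blast
qed

locale number_field_setup =
  fixes K :: "'a::{alg_closed_field, field_char_0} set"
  assumes number_field: "number_field K"
begin

abbreviation ints :: "'a set" ("\<O>") where
  "\<O> \<equiv> carrier (ring_of_integers K)"

lemma ints_iff: "x \<in> \<O> \<longleftrightarrow> x \<in> K \<and> algebraic_int x"
  by (simp add: ring_of_integers_def)

lemma subfield_K: "subfield K ring_of_type_algebra"
  using number_field by (simp add: number_field_def)

lemmas K_closed = subfield_closed[OF subfield_K]

lemma K_diff: "x \<in> K \<Longrightarrow> y \<in> K \<Longrightarrow> x - y \<in> K"
  using K_closed(3)[of x "- y"] K_closed(5)[of y] by simp

lemma K_divide: "x \<in> K \<Longrightarrow> y \<in> K \<Longrightarrow> x / y \<in> K"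
  using K_closed(4)[of x "inverse y"] K_closed(6)[of y] by (simp add: divide_inverse)

lemma K_power: "x \<in> K \<Longrightarrow> x ^ n \<in> K"
  by (induction n) (auto intro: K_closed)

lemma K_of_nat: "of_nat n \<in> K"
  by (induction n) (auto intro: K_closed)

lemma K_of_int: "of_int n \<in> K"
  by (cases n) (auto intro: K_closed K_of_nat K_diff)

lemma K_of_rat: "of_rat r \<in> K"
  by (cases r) (auto simp: of_rat_rat intro: K_divide K_of_int)

lemma ints_zero: "0 \<in> \<O>" and ints_one: "1 \<in> \<O>"
  and ints_of_nat: "of_nat n \<in> \<O>" and ints_of_int: "of_int k \<in> \<O>"
  using K_closed K_of_nat K_of_int by (auto simp: ints_iff)

lemma ints_add: "x \<in> \<O> \<Longrightarrow> y \<in> \<O> \<Longrightarrow> x + y \<in> \<O>"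
  using K_closed algebraic_int_plus by (auto simp: ints_iff)

lemma ints_mult: "x \<in> \<O> \<Longrightarrow> y \<in> \<O> \<Longrightarrow> x * y \<in> \<O>"
  using K_closed algebraic_int_times by (auto simp: ints_iff)

lemma ints_minus: "x \<in> \<O> \<Longrightarrow> - x \<in> \<O>"
  using K_closed by (auto simp: ints_iff)

lemma ints_diff: "x \<in> \<O> \<Longrightarrow> y \<in> \<O> \<Longrightarrow> x - y \<in> \<O>"
  using ints_add[of x "- y"] ints_minus by auto

lemma ints_power: "x \<in> \<O> \<Longrightarrow> x ^ n \<in> \<O>"
  by (induction n) (auto intro: ints_one ints_mult)

lemma ints_sum: "(\<And>i. i \<in> I \<Longrightarrow> f i \<in> \<O>) \<Longrightarrow> sum f I \<in> \<O>"
  by (induction I rule: infinite_finite_induct) (auto intro: ints_zero ints_add)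

lemmas ints_intros = ints_zero ints_one ints_of_nat ints_of_int ints_add ints_mult ints_minus
  ints_diff ints_power ints_sum

lemma integer_relation_bound:
  "\<exists>n. \<forall>S. finite S \<and> S \<subseteq> K \<and> card S > n \<longrightarrow>
    (\<exists>c::'a \<Rightarrow> int. (\<exists>s\<in>S. c s \<noteq> 0) \<and> (\<Sum>s\<in>S. of_int (c s) * s) = 0)"
proof -
  obtain B where B: "finite B" "K \<subseteq> rat_space.span B"
    using number_field unfolding number_field_def by (metis finite_dimension_rat_span)
  show ?thesis
  proof (intro exI[of _ "card B"] allI impI)
    fix S assume "finite S \<and> S \<subseteq> K \<and> card S > card B"
    then have S: "finite S" "S \<subseteq> K" "card S > card B" by auto
    have "rat_space.dependent S"
      using rat_space.independent_span_bound[OF B(1), of S] B S by auto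
    then obtain u v where u: "v \<in> S" "u v \<noteq> 0" "(\<Sum>s\<in>S. of_rat (u s) * s) = 0"
      unfolding rat_space.dependent_finite[OF S(1)] by blast
    obtain d :: int where d: "d \<noteq> 0" "\<And>s. s \<in> S \<Longrightarrow> of_int d * u s \<in> \<int>"
      using clear_denominators[OF S(1), of u] by blast
    define c where "c s = \<lfloor>of_int d * u s\<rfloor>" for s
    have c: "of_int (c s) = of_int d * u s" if "s \<in> S" for s
      using d(2)[OF that] by (auto simp: c_def elim: Ints_cases)
    have c': "(of_int (c s) :: 'a) = of_int d * of_rat (u s)" if "s \<in> S" for s
      using arg_cong[OF c[OF that], of "of_rat :: rat \<Rightarrow> 'a"] by (simp add: of_rat_mult)
    have "(\<Sum>s\<in>S. of_int (c s) * s) = of_int d * (\<Sum>s\<in>S. of_rat (u s) * s)"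
      unfolding sum_distrib_left by (intro sum.cong) (auto simp: c')
    then have "(\<Sum>s\<in>S. of_int (c s) * s) = 0" using u by simp
    moreover have "c v \<noteq> 0" using c[OF u(1)] d(1) u(2) by auto
    ultimately show "\<exists>c::'a \<Rightarrow> int. (\<exists>s\<in>S. c s \<noteq> 0) \<and> (\<Sum>s\<in>S. of_int (c s) * s) = 0"
      using u(1) by blast
  qed
qed

lemma K_algebraic:
  assumes x: "x \<in> K"
  shows "algebraic x"
proof -
  obtain n where n: "\<And>S. finite S \<Longrightarrow> S \<subseteq> K \<Longrightarrow> card S > n \<Longrightarrow>
    \<exists>c::'a \<Rightarrow> int. (\<exists>s\<in>S. c s \<noteq> 0) \<and> (\<Sum>s\<in>S. of_int (c s) * s) = 0"
    using integer_relation_bound by blast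
  show ?thesis
  proof (cases "inj_on (\<lambda>i. x ^ i) {..n}")
    case False
    then obtain i j where ij: "x ^ i = x ^ j" "i \<noteq> j" by (auto simp: inj_on_def)
    show ?thesis
    proof (rule algebraicI)
      show "poly (monom 1 i - monom 1 j) x = 0" using ij by (simp add: poly_monom)
      have "coeff (monom 1 i - monom 1 j :: 'a poly) i = 1" using ij by simp
      then show "monom 1 i - monom 1 j \<noteq> (0 :: 'a poly)" by (metis coeff_0 zero_neq_one)
    qed auto
  next
    case True
    define S where "S = (\<lambda>i. x ^ i) ` {..n}"
    have "card S = Suc n" unfolding S_def by (simp add: card_image True)
    then obtain c :: "'a \<Rightarrow> int" and s where c: "s \<in> S" "c s \<noteq> 0" "(\<Sum>s\<in>S. of_int (c s) * s) = 0"
      using n[of S] x K_power by (auto simp: S_def)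
    have rel: "(\<Sum>i\<le>n. of_int (c (x ^ i)) * x ^ i) = 0"
      using c(3) by (simp add: S_def sum.reindex[OF True])
    obtain i where i: "i \<le> n" "s = x ^ i" using c(1) by (auto simp: S_def)
    define p where "p = (\<Sum>i\<le>n. monom (of_int (c (x ^ i)) :: 'a) i)"
    have coeff_p: "coeff p k = (if k \<le> n then of_int (c (x ^ k)) else 0)" for k
      by (simp add: p_def coeff_sum)
    show ?thesis
    proof (rule algebraicI)
      show "poly p x = 0" using rel by (simp add: p_def poly_sum poly_monom)
      have "coeff p i \<noteq> 0" using c(2) i by (simp add: coeff_p)
      then show "p \<noteq> 0" by auto
    qed (simp add: coeff_p)
  qed
qed

lemma K_eq_int_quotient:
  assumes "x \<in> K"
  obtains a and m :: int where "a \<in> \<O>" "m \<noteq> 0" "x = a / of_int m"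
proof -
  obtain m :: int where m: "m \<noteq> 0" "algebraic_int (of_int m * x)"
    using algebraic_int_multiple[OF K_algebraic[OF assms]] .
  show ?thesis
    by (rule that[of "of_int m * x" m]) (use m assms K_closed K_of_int in \<open>auto simp: ints_iff\<close>)
qed

lemma ints_dvd_integer:
  assumes "a \<in> \<O>" "a \<noteq> 0"
  obtains b and m :: int where "b \<in> \<O>" "m \<noteq> 0" "a * b = of_int m"
proof -
  have "inverse a \<in> K" using assms K_closed by (auto simp: ints_iff)
  then obtain b and m :: int where "b \<in> \<O>" "m \<noteq> 0" "inverse a = b / of_int m"
    by (rule K_eq_int_quotient)
  moreover from this have "a * b = of_int m" using assms by (simp add: field_simps)
  ultimately show ?thesis using that by blast
qed

definition independent_mod :: "nat \<Rightarrow> 'a set \<Rightarrow> bool" where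
  "independent_mod q S \<longleftrightarrow> finite S \<and> S \<subseteq> \<O> \<and>
     (\<forall>(c::'a \<Rightarrow> int). \<forall>y\<in>\<O>. (\<Sum>s\<in>S. of_int (c s) * s) = of_nat q * y \<longrightarrow> (\<forall>s\<in>S. int q dvd c s))"

lemma independent_mod_relation_zero:
  assumes S: "independent_mod q S" and q: "q > 1" and s: "s \<in> S"
  shows "(\<Sum>s\<in>S. of_int (c s) * s) = 0 \<Longrightarrow> c s = 0"
proof (induction "nat \<bar>c s\<bar>" arbitrary: c rule: less_induct)
  case less
  have dvd: "int q dvd c t" if "t \<in> S" for t
  proof -
    have "(\<Sum>s\<in>S. of_int (c s) * s) = of_nat q * 0" using less.prems by simp
    then show ?thesis using S ints_zero that unfolding independent_mod_def by blast
  qed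
  define c' where "c' t = c t div int q" for t
  have c': "c t = int q * c' t" if "t \<in> S" for t using dvd[OF that] by (simp add: c'_def)
  have "of_nat q * (\<Sum>s\<in>S. of_int (c' s) * s) = (\<Sum>s\<in>S. of_int (c s) * s)"
    unfolding sum_distrib_left by (intro sum.cong) (auto simp: c')
  then have rel: "(\<Sum>s\<in>S. of_int (c' s) * s) = 0" using less.prems q by auto
  show ?case
  proof (rule ccontr)
    assume nz: "c s \<noteq> 0"
    then have "c' s \<noteq> 0" using c'[OF s] by auto
    moreover have "\<bar>c s\<bar> = int q * \<bar>c' s\<bar>" using c'[OF s] by (simp add: abs_mult)
    moreover have "int q * \<bar>c' s\<bar> > 1 * \<bar>c' s\<bar>" using q \<open>c' s \<noteq> 0\<close> by (intro mult_strict_right_mono) auto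
    ultimately have "nat \<bar>c' s\<bar> < nat \<bar>c s\<bar>" by simp
    then show False using less.hyps rel \<open>c' s \<noteq> 0\<close> by blast
  qed
qed

text \<open>
  No integral basis is needed: elements of \<open>\<O>\<close> that are linearly independent modulo \<open>q\<close> are
  linearly independent over the rationals, so \<open>\<O> / q\<O>\<close> has dimension at most the degree of \<open>K\<close>.
\<close>
lemma finite_residues:
  assumes q: "Factorial_Ring.prime q"
  shows "\<exists>B. finite B \<and> (\<forall>x\<in>\<O>. \<exists>b\<in>B. \<exists>y\<in>\<O>. x = b + of_nat q * y)"
proof -
  have q1: "q > 1" using prime_gt_1_nat[OF q] .
  obtain n where n: "\<And>S. finite S \<Longrightarrow> S \<subseteq> K \<Longrightarrow> card S > n \<Longrightarrow>
    \<exists>c::'a \<Rightarrow> int. (\<exists>s\<in>S. c s \<noteq> 0) \<and> (\<Sum>s\<in>S. of_int (c s) * s) = 0"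
    using integer_relation_bound by blast
  have bound: "card S \<le> n" if S: "independent_mod q S" for S
  proof (rule ccontr)
    assume "\<not> card S \<le> n"
    moreover have "finite S" "S \<subseteq> K" using S by (auto simp: independent_mod_def ints_iff)
    ultimately obtain c :: "'a \<Rightarrow> int" and s
      where "s \<in> S" "c s \<noteq> 0" "(\<Sum>s\<in>S. of_int (c s) * s) = 0"
      using n[of S] by auto
    then show False
      using independent_mod_relation_zero[OF S q1] by blast
  qed
  have "independent_mod q {}" by (simp add: independent_mod_def)
  then obtain S where S: "independent_mod q S"
    and max: "\<And>T. independent_mod q T \<Longrightarrow> card T \<le> card S"
    using ex_has_greatest_nat[of "independent_mod q" "{}" card "Suc n"] bound
    by (metis less_Suc_eq_le)
  have fin: "finite S" and sub: "S \<subseteq> \<O>" using S by (auto simp: independent_mod_def)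
  have gen: "\<exists>c::'a \<Rightarrow> int. \<exists>y\<in>\<O>. x = (\<Sum>s\<in>S. of_int (c s) * s) + of_nat q * y" if x: "x \<in> \<O>" for x
  proof (cases "x \<in> S")
    case True
    have "(\<Sum>s\<in>S. of_int (if s = x then 1 else 0) * s) = (\<Sum>s\<in>S. if s = x then s else 0)"
      by (intro sum.cong) auto
    then have "x = (\<Sum>s\<in>S. of_int (if s = x then 1 else 0) * s) + of_nat q * 0"
      using True fin by (simp add: sum.delta)
    then show ?thesis
      by (intro exI[of _ "\<lambda>s. if s = x then 1 else 0"] bexI[of _ 0] ints_zero)
  next
    case False
    then have "\<not> independent_mod q (insert x S)" using max[of "insert x S"] fin by auto
    then obtain c :: "'a \<Rightarrow> int" and y t where c: "y \<in> \<O>"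
        "(\<Sum>s\<in>insert x S. of_int (c s) * s) = of_nat q * y"
      and t: "t \<in> insert x S" "\<not> int q dvd c t"
      using fin sub x unfolding independent_mod_def by blast
    have rel: "of_int (c x) * x + (\<Sum>s\<in>S. of_int (c s) * s) = of_nat q * y"
      using c(2) fin False by simp
    have "\<not> int q dvd c x"
    proof
      assume dvd: "int q dvd c x"
      then obtain k where k: "c x = int q * k" by blast
      have "(\<Sum>s\<in>S. of_int (c s) * s) = of_nat q * (y - of_int k * x)"
        using rel by (simp add: k algebra_simps)
      moreover have "y - of_int k * x \<in> \<O>" using c x by (intro ints_intros)
      ultimately have "\<forall>s\<in>S. int q dvd c s" using S unfolding independent_mod_def by blast
      then show False using t dvd by blast
    qed
    then have "coprime (int q) (c x)"
      using q prime_imp_coprime[of "int q" "c x"] by (simp add: prime_nat_int_transfer)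
    then obtain a b where ab: "a * int q + b * c x = 1"
      using bezout_int[of "int q" "c x"] by (metis coprime_iff_gcd_eq_1)
    have "x = of_int (a * int q + b * c x) * x" by (simp add: ab)
    also have "\<dots> = of_int b * (of_int (c x) * x) + of_nat q * (of_int a * x)"
      by (simp add: algebra_simps)
    also have "of_int (c x) * x = of_nat q * y - (\<Sum>s\<in>S. of_int (c s) * s)"
      using rel by (simp add: algebra_simps)
    finally have "x = (\<Sum>s\<in>S. of_int (- b * c s) * s) + of_nat q * (of_int b * y + of_int a * x)"
      by (simp add: algebra_simps sum_distrib_left sum_negf)
    moreover have "of_int b * y + of_int a * x \<in> \<O>" using c x by (intro ints_intros)
    ultimately show ?thesis by (intro exI[of _ "\<lambda>s. - b * c s"]) blast
  qed
  define B where "B = (\<lambda>c. \<Sum>s\<in>S. of_int (c s) * s) ` (S \<rightarrow>\<^sub>E {0..<int q})"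
  show ?thesis
  proof (intro exI[of _ B] conjI ballI)
    show "finite B" unfolding B_def using fin by (intro finite_imageI finite_PiE) auto
    fix x assume "x \<in> \<O>"
    then obtain c :: "'a \<Rightarrow> int" and y where c: "y \<in> \<O>"
        "x = (\<Sum>s\<in>S. of_int (c s) * s) + of_nat q * y"
      using gen by blast
    define c0 where "c0 = (\<lambda>s\<in>S. c s mod int q)"
    have c0: "c0 \<in> S \<rightarrow>\<^sub>E {0..<int q}" using q1 by (auto simp: c0_def)
    have "of_int (c s) * s = of_int (c0 s) * s + of_nat q * (of_int (c s div int q) * s)"
      if "s \<in> S" for s
    proof -
      have "c s = c0 s + int q * (c s div int q)" using that by (simp add: c0_def)
      then have "(of_int (c s) :: 'a) = of_int (c0 s) + of_nat q * of_int (c s div int q)"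
        by (metis of_int_add of_int_mult of_int_of_nat_eq)
      then show ?thesis by (simp add: algebra_simps)
    qed
    then have "x = (\<Sum>s\<in>S. of_int (c0 s) * s) + of_nat q * ((\<Sum>s\<in>S. of_int (c s div int q) * s) + y)"
      unfolding c(2) by (simp add: sum.distrib sum_distrib_left distrib_left)
    moreover have "(\<Sum>s\<in>S. of_int (c s div int q) * s) + y \<in> \<O>"
      using c sub by (intro ints_intros) auto
    ultimately show "\<exists>b\<in>B. \<exists>y\<in>\<O>. x = b + of_nat q * y"
      unfolding B_def using c0 by blast
  qed
qed

end

section \<open>Galois closures\<close>

lemma subfield_Rats: "subfield (\<rat> :: 'a::field_char_0 set) ring_of_type_algebra"
proof (rule field.subfieldI'[OF field_from_type_algebra])
  show "subring (\<rat> :: 'a set) ring_of_type_algebra"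
    by (rule type_ring.subringI) auto
qed (auto simp: Rats_inverse)

lemma type_ring_eval_rev_coeffs:
  "type_ring.eval (rev (coeffs p)) x = poly p (x::'a::Fields.field)"
proof (induction p)
  case (pCons a p)
  have "type_ring.eval (rev (coeffs p) @ [a]) x = type_ring.eval (rev (coeffs p)) x * x + a"
    using type_ring.eval_append_aux[of "rev (coeffs p)" a x] by simp
  then show ?case using pCons by (simp add: mult.commute add.commute cCons_def)
qed simp

lemma type_ring_algebraicI:
  fixes x :: "'a::field_char_0"
  assumes "algebraic x"
  shows "(type_ring.algebraic over \<rat>) x"
proof -
  obtain p where p: "\<And>i. coeff p i \<in> \<int>" "p \<noteq> 0" "poly p x = 0"
    using assms unfolding algebraic_def by blast
  have "coeff p i \<in> \<rat>" for i using p(1)[of i] Ints_subset_Rats by blast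
  then have "range (coeff p) \<subseteq> \<rat>" by auto
  then have "set (coeffs p) \<subseteq> \<rat>" by (simp add: range_coeff)
  then have "polynomial\<^bsub>ring_of_type_algebra\<^esub> \<rat> (rev (coeffs p))"
    using p(2) by (simp add: polynomial_def hd_rev last_coeffs_eq_coeff_degree)
  then show ?thesis
    using p by (intro type_ring.algebraicI[of "rev (coeffs p)"])
      (auto simp: univ_poly_carrier type_ring_eval_rev_coeffs)
qed

locale field_embedding =
  fixes F :: "'a::{alg_closed_field, field_char_0} set" and \<phi> :: "'a \<Rightarrow> 'a"
  assumes subfield: "subfield F ring_of_type_algebra"
    and hom_one: "\<phi> 1 = 1"
    and hom_add: "\<And>x y. x \<in> F \<Longrightarrow> y \<in> F \<Longrightarrow> \<phi> (x + y) = \<phi> x + \<phi> y"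
    and hom_mult: "\<And>x y. x \<in> F \<Longrightarrow> y \<in> F \<Longrightarrow> \<phi> (x * y) = \<phi> x * \<phi> y"
begin

lemmas F_closed = subfield_closed[OF subfield]

lemma hom_zero: "\<phi> 0 = 0"
  using hom_add[of 0 0] F_closed by simp

lemma hom_minus: "x \<in> F \<Longrightarrow> \<phi> (- x) = - \<phi> x"
  using hom_add[of x "- x"] F_closed(5)[of x] hom_zero by (simp add: eq_neg_iff_add_eq_0 add.commute)

lemma hom_nonzero: "x \<in> F \<Longrightarrow> x \<noteq> 0 \<Longrightarrow> \<phi> x \<noteq> 0"
  using hom_mult[of x "inverse x"] F_closed(6)[of x] hom_one by auto

lemma F_sum: "(\<And>i. i \<in> I \<Longrightarrow> f i \<in> F) \<Longrightarrow> sum f I \<in> F"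
  by (induction I rule: infinite_finite_induct) (auto intro: F_closed)

lemma hom_sum: "(\<And>i. i \<in> I \<Longrightarrow> f i \<in> F) \<Longrightarrow> \<phi> (sum f I) = (\<Sum>i\<in>I. \<phi> (f i))"
  by (induction I rule: infinite_finite_induct) (auto simp: hom_zero hom_add F_sum)

lemma F_power: "x \<in> F \<Longrightarrow> x ^ n \<in> F"
  by (induction n) (auto intro: F_closed)

lemma hom_power: "x \<in> F \<Longrightarrow> \<phi> (x ^ n) = \<phi> x ^ n"
  by (induction n) (auto simp: hom_one hom_mult F_power)

lemma F_of_nat: "of_nat n \<in> F" and hom_of_nat: "\<phi> (of_nat n) = of_nat n"
proof -
  show F: "of_nat n \<in> F" for n by (induction n) (auto intro: F_closed)
  show "\<phi> (of_nat n) = of_nat n" by (induction n) (auto simp: hom_zero hom_one hom_add F F_closed)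
qed

lemma F_of_int: "of_int n \<in> F" and hom_of_int: "\<phi> (of_int n) = of_int n"
proof -
  have "of_int n \<in> F \<and> \<phi> (of_int n) = of_int n"
  proof (cases n rule: int_cases2)
    case (nonneg m)
    then show ?thesis by (simp add: F_of_nat hom_of_nat)
  next
    case (nonpos m)
    then show ?thesis by (simp add: F_of_nat hom_of_nat hom_minus F_closed)
  qed
  then show "of_int n \<in> F" "\<phi> (of_int n) = of_int n" by auto
qed

definition over_F :: "'a poly \<Rightarrow> bool" where
  "over_F p \<longleftrightarrow> (\<forall>i. coeff p i \<in> F)"

lemma over_F_closed:
  "over_F 0" "over_F 1"
  "over_F p \<Longrightarrow> over_F q \<Longrightarrow> over_F (p + q)"
  "over_F p \<Longrightarrow> over_F (- p)"
  "over_F p \<Longrightarrow> over_F q \<Longrightarrow> over_F (p * q)"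
  "a \<in> F \<Longrightarrow> over_F (monom a n)"
  by (auto simp: over_F_def coeff_mult one_pCons coeff_pCons F_closed split: nat.split intro!: F_closed F_sum)

lemma coeff_map_hom: "coeff (map_poly \<phi> p) i = \<phi> (coeff p i)"
  by (simp add: coeff_map_poly hom_zero)

lemma map_hom_add: "over_F p \<Longrightarrow> over_F q \<Longrightarrow> map_poly \<phi> (p + q) = map_poly \<phi> p + map_poly \<phi> q"
  by (intro poly_eqI) (auto simp: coeff_map_hom over_F_def hom_add)

lemma map_hom_minus: "over_F p \<Longrightarrow> map_poly \<phi> (- p) = - map_poly \<phi> p"
  by (intro poly_eqI) (auto simp: coeff_map_hom over_F_def hom_minus)

lemma map_hom_mult: "over_F p \<Longrightarrow> over_F q \<Longrightarrow> map_poly \<phi> (p * q) = map_poly \<phi> p * map_poly \<phi> q"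
  by (intro poly_eqI) (auto simp: coeff_map_hom over_F_def coeff_mult hom_sum hom_mult F_closed)

lemma degree_map_hom: "over_F p \<Longrightarrow> degree (map_poly \<phi> p) = degree p"
proof (cases "p = 0")
  case False
  assume p: "over_F p"
  have "coeff (map_poly \<phi> p) (degree p) \<noteq> 0"
    unfolding coeff_map_hom using p False by (intro hom_nonzero) (auto simp: over_F_def)
  then have "degree p \<le> degree (map_poly \<phi> p)" by (rule le_degree)
  then show ?thesis using degree_map_poly_le[of \<phi> p] by simp
qed simp

lemma hom_poly:
  assumes p: "over_F p" and x: "x \<in> F"
  shows "\<phi> (poly p x) = poly (map_poly \<phi> p) (\<phi> x)"
proof -
  have "\<phi> (poly p x) = (\<Sum>i\<le>degree p. \<phi> (coeff p i * x ^ i))"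
    unfolding poly_altdef using p x by (intro hom_sum) (auto simp: over_F_def F_closed F_power)
  also have "\<dots> = (\<Sum>i\<le>degree p. \<phi> (coeff p i) * \<phi> x ^ i)"
    using p x by (intro sum.cong) (auto simp: over_F_def hom_mult hom_power F_power)
  finally show ?thesis by (simp add: poly_altdef degree_map_hom[OF p] coeff_map_hom)
qed

lemma ex_conjugate_root:
  assumes "algebraic r"
  obtains r' where "\<And>g. over_F g \<Longrightarrow> poly g r = 0 \<Longrightarrow> poly (map_poly \<phi> g) r' = 0"
proof -
  define Z where "Z g \<longleftrightarrow> over_F g \<and> g \<noteq> 0 \<and> poly g r = 0" for g
  obtain p where p: "p \<noteq> 0" "poly (map_poly of_int p) r = 0"
    using assms by (rule algebraicE')
  have "Z (map_poly of_int p)"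
    using p by (auto simp: Z_def over_F_def coeff_map_poly F_of_int map_poly_eq_0_iff)
  then obtain m where m: "Z m" and min: "\<And>g. Z g \<Longrightarrow> degree m \<le> degree g"
    using ex_has_least_nat[of Z _ degree] by blast
  have mF: "over_F m" and m0: "m \<noteq> 0" and mr: "poly m r = 0" using m by (auto simp: Z_def)
  have deg: "degree m > 0"
  proof (rule ccontr)
    assume "\<not> degree m > 0"
    then obtain a where "m = [:a:]" using degree_eq_zeroE by blast
    then show False using m0 mr by simp
  qed
  obtain r' where r': "poly (map_poly \<phi> m) r' = 0"
    using alg_closed_imp_poly_has_root[of "map_poly \<phi> m"] deg degree_map_hom[OF mF] by auto
  have "poly (map_poly \<phi> g) r' = 0" if "over_F g" "poly g r = 0" for g
    using that
  proof (induction "degree g" arbitrary: g rule: less_induct)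
    case less
    show ?case
    proof (cases "g = 0")
      case False
      then have "Z g" using less.prems by (simp add: Z_def)
      then have le: "degree m \<le> degree g" by (rule min)
      define t where "t = monom (lead_coeff g * inverse (lead_coeff m)) (degree g - degree m)"
      have tF: "over_F t"
        unfolding t_def using less.prems mF F_closed by (intro over_F_closed) (auto simp: over_F_def)
      define h where "h = g + - (t * m)"
      have hF: "over_F h" unfolding h_def using less.prems mF tF by (intro over_F_closed)
      have hr: "poly h r = 0" using less.prems mr by (simp add: h_def)
      have "lead_coeff g * inverse (lead_coeff m) \<noteq> 0" using False m0 by simp
      then have dt: "degree t = degree g - degree m" by (simp add: t_def degree_monom_eq)
      have "t \<noteq> 0" using False m0 by (simp add: t_def)
      then have dtm: "degree (t * m) = degree g" using m0 le by (simp add: degree_mult_eq dt)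
      have "lead_coeff (t * m) = lead_coeff g"
        unfolding lead_coeff_mult dt using m0 by (simp add: t_def)
      then have ch: "coeff h (degree g) = 0" by (simp add: h_def dtm)
      have "degree h \<le> degree g" unfolding h_def
        using degree_add_le[of g "degree g" "- (t * m)"] dtm by simp
      moreover have "degree h \<noteq> degree g"
      proof
        assume "degree h = degree g"
        then have "h = 0" using ch by (metis leading_coeff_0_iff)
        then show False using \<open>degree h = degree g\<close> le deg by simp
      qed
      ultimately have "poly (map_poly \<phi> h) r' = 0" using less.hyps hF hr by simp
      moreover have "g = h + t * m" by (simp add: h_def)
      then have "map_poly \<phi> g = map_poly \<phi> h + map_poly \<phi> t * map_poly \<phi> m"
        using hF tF mF by (simp add: map_hom_add map_hom_mult over_F_closed)
      ultimately show ?thesis using r' by simp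
    qed simp
  qed
  then show ?thesis using that by blast
qed

lemma extend_simple:
  assumes alg: "algebraic r" "(type_ring.algebraic over F) r"
    and root: "\<And>g. over_F g \<Longrightarrow> poly g r = 0 \<Longrightarrow> poly (map_poly \<phi> g) r' = 0"
  obtains \<psi> where "field_embedding (type_ring.simple_extension F r) \<psi>"
    "\<And>x. x \<in> F \<Longrightarrow> \<psi> x = \<phi> x" "\<psi> r = r'"
proof -
  define \<psi> where "\<psi> x = poly (map_poly \<phi> (SOME g. over_F g \<and> poly g r = x)) r'" for x
  have \<psi>: "\<psi> (poly g r) = poly (map_poly \<phi> g) r'" if g: "over_F g" for g
  proof -
    define h where "h = (SOME h. over_F h \<and> poly h r = poly g r)"
    have h: "over_F h \<and> poly h r = poly g r"
      unfolding h_def by (rule someI[of _ g]) (use g in simp)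
    have "poly (map_poly \<phi> (h + - g)) r' = 0"
      by (rule root[OF over_F_closed(3)[OF _ over_F_closed(4)]]) (use h g in auto)
    then have "poly (map_poly \<phi> h) r' + - poly (map_poly \<phi> g) r' = 0"
      using h g by (simp add: map_hom_add map_hom_minus over_F_closed del: add_uminus_conv_diff)
    then have "poly (map_poly \<phi> h) r' = poly (map_poly \<phi> g) r'" by simp
    then show ?thesis unfolding \<psi>_def h_def .
  qed
  have gen: "\<exists>g. over_F g \<and> x = poly g r" if "x \<in> type_ring.simple_extension F r" for x
    using that
  proof (induction rule: type_ring.simple_extension.induct)
    case zero
    then show ?case using over_F_closed(1) by (intro exI[of _ 0]) simp
  next
    case (lin k1 k2)
    then obtain g where g: "over_F g" "k1 = poly g r" by blast
    then show ?case using lin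
      by (intro exI[of _ "g * monom 1 1 + monom k2 0"])
        (auto intro!: over_F_closed F_closed simp: poly_monom)
  qed
  have on_F: "\<psi> x = \<phi> x" if "x \<in> F" for x
    using \<psi>[of "monom x 0"] that by (simp add: over_F_closed poly_monom map_poly_monom hom_zero)
  show ?thesis
  proof (rule that[of \<psi>])
    show "field_embedding (type_ring.simple_extension F r) \<psi>"
    proof (rule field_embedding.intro)
      show "subfield (type_ring.simple_extension F r) ring_of_type_algebra"
        using type_ring.simple_extension_is_subfield[OF subfield] alg by simp
      show "\<psi> 1 = 1" using on_F[OF F_closed(2)] hom_one by simp
      fix x y assume "x \<in> type_ring.simple_extension F r" "y \<in> type_ring.simple_extension F r"
      then obtain g h where g: "over_F g" "x = poly g r" and h: "over_F h" "y = poly h r"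
        using gen by metis
      have "\<psi> (poly (g + h) r) = \<psi> x + \<psi> y" "\<psi> (poly (g * h) r) = \<psi> x * \<psi> y"
        unfolding \<psi>[OF over_F_closed(3)[OF g(1) h(1)]] \<psi>[OF over_F_closed(5)[OF g(1) h(1)]]
        using g h by (simp_all add: \<psi> map_hom_add map_hom_mult)
      then show "\<psi> (x + y) = \<psi> x + \<psi> y" "\<psi> (x * y) = \<psi> x * \<psi> y" using g h by simp_all
    qed
    show "\<psi> r = r'"
      using \<psi>[of "monom 1 1"] by (simp add: over_F_closed F_closed poly_monom map_poly_monom hom_zero hom_one)
  qed (rule on_F)
qed

lemma Rats_subset_F: "\<rat> \<subseteq> F"
proof
  fix x :: 'a assume "x \<in> \<rat>"
  then obtain a b :: int where "x = of_int a / of_int b" by (auto elim!: Rats_cases')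
  then show "x \<in> F" using F_of_int F_closed by (simp add: divide_inverse)
qed

lemma extend_finite:
  assumes "\<And>r. r \<in> set rs \<Longrightarrow> algebraic r"
  shows "\<exists>\<psi>. field_embedding (type_ring.finite_extension F rs) \<psi> \<and> (\<forall>x\<in>F. \<psi> x = \<phi> x)"
  using assms
proof (induction rs)
  case Nil
  then show ?case using field_embedding_axioms by auto
next
  case (Cons r rs)
  let ?M = "type_ring.finite_extension F rs"
  obtain \<psi> where \<psi>: "field_embedding ?M \<psi>" and ext: "\<And>x. x \<in> F \<Longrightarrow> \<psi> x = \<phi> x"
    using Cons by auto
  interpret M: field_embedding ?M \<psi> by (rule \<psi>)
  have r: "algebraic r" using Cons.prems by simp
  have rM: "(type_ring.algebraic over ?M) r"
    using type_ring.algebraic_mono[OF M.Rats_subset_F type_ring_algebraicI[OF r]] .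
  obtain r' where r': "\<And>g. M.over_F g \<Longrightarrow> poly g r = 0 \<Longrightarrow> poly (map_poly \<psi> g) r' = 0"
    using M.ex_conjugate_root[OF r] by blast
  obtain \<theta> where \<theta>: "field_embedding (type_ring.simple_extension ?M r) \<theta>" "\<And>x. x \<in> ?M \<Longrightarrow> \<theta> x = \<psi> x"
    using M.extend_simple[OF r rM r'] by blast
  have "F \<subseteq> ?M" by (rule type_ring.finite_extension_incl) auto
  then show ?case using \<theta> ext by (intro exI[of _ \<theta>]) auto
qed

end

lemma map_poly_of_rat_add:
  "map_poly of_rat (p + q) = (map_poly of_rat p + map_poly of_rat q :: 'a::field_char_0 poly)"
  by (intro poly_eqI) (simp add: coeff_map_poly of_rat_add)

lemma map_poly_of_rat_mult:
  "map_poly of_rat (p * q) = (map_poly of_rat p * map_poly of_rat q :: 'a::field_char_0 poly)"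
  by (intro poly_eqI) (simp add: coeff_map_poly coeff_mult of_rat_sum of_rat_mult)

lemma irreducible_dvd_if_common_root:
  fixes p g :: "rat poly" and a :: "'a::field_char_0"
  assumes p: "Factorial_Ring.irreducible p" "poly (map_poly of_rat p) a = 0"
    and g: "poly (map_poly of_rat g) a = 0"
  shows "p dvd g"
proof (rule ccontr)
  assume "\<not> p dvd g"
  then have "coprime p g"
    using p(1) by (simp add: prime_elem_imp_coprime irreducible_imp_prime_elem_gcd)
  then obtain u v where "u * p + v * g = 1"
    by (metis bezout_coefficients_fst_snd coprime_imp_gcd_eq_1)
  then have "poly (map_poly of_rat (u * p + v * g)) a = 1" by simp
  then show False using p(2) g by (simp add: map_poly_of_rat_add map_poly_of_rat_mult)
qed

lemma irreducible_rat_poly_splits: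
  fixes p :: "rat poly"
  assumes p: "Factorial_Ring.irreducible p"
  defines "P \<equiv> map_poly of_rat p :: 'a::{alg_closed_field, field_char_0} poly"
  shows "P = Polynomial.smult (of_rat (lead_coeff p)) (\<Prod>a | poly P a = 0. [:- a, 1:])"
proof -
  have p0: "p \<noteq> 0" using p by auto
  have P0: "P \<noteq> 0" using p0 by (simp add: P_def)
  have lc: "lead_coeff P = of_rat (lead_coeff p)" by (simp add: P_def)
  have "degree p > 0" using irreducible_not_unit[OF p] is_unit_iff_degree[OF p0] p0 by blast
  have "rsquarefree P"
    unfolding rsquarefree_roots
  proof (intro allI notI)
    fix a assume a: "poly P a = 0 \<and> poly (pderiv P) a = 0"
    have "pderiv P = map_poly of_rat (pderiv p)"
      by (intro poly_eqI) (simp add: P_def coeff_pderiv of_rat_mult of_rat_add)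
    then have "p dvd pderiv p"
      using irreducible_dvd_if_common_root[OF p, of a "pderiv p"] a by (simp add: P_def)
    moreover have "pderiv p \<noteq> 0" using \<open>degree p > 0\<close> by (simp add: pderiv_eq_0_iff)
    ultimately have "degree p \<le> degree (pderiv p)" by (rule dvd_imp_degree_le)
    then show False using \<open>degree p > 0\<close> by (simp add: degree_pderiv)
  qed
  obtain A where A: "P = Polynomial.smult (lead_coeff P) (\<Prod>x\<in>#A. [:- x, 1:])"
    using alg_closed_imp_factorization[OF P0] by blast
  have roots: "poly P a = 0 \<longleftrightarrow> a \<in># A" for a
    using P0 by (subst A) (auto simp: poly_prod_mset prod_mset_zero_iff)
  have "count A x \<le> 1" for x
  proof (rule ccontr)
    assume "\<not> count A x \<le> 1"
    then have "replicate_mset 2 x \<subseteq># A" by (simp add: count_le_replicate_mset_subset_eq[symmetric])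
    then obtain B where B: "A = replicate_mset 2 x + B" by (metis subset_mset.le_iff_add)
    have "[:- x, 1:] ^ 2 dvd P" by (subst A) (simp add: B dvd_smult)
    then have "Polynomial.order x P \<ge> 2" using P0 by (simp add: order_divides)
    moreover have "Polynomial.order x P = 0 \<or> Polynomial.order x P = 1" using \<open>rsquarefree P\<close> by (simp add: rsquarefree_def)
    ultimately show False by linarith
  qed
  then have "A = mset_set (set_mset A)"
    by (intro multiset_eqI) (metis count_eq_zero_iff count_mset_set finite_set_mset le_less less_one)
  then have "(\<Prod>x\<in>#A. [:- x, 1:]) = (\<Prod>x\<in>set_mset A. [:- x, 1:])"
    by (metis prod_unfold_prod_mset)
  also have "set_mset A = {a. poly P a = 0}" using roots by auto
  finally show ?thesis using A lc by simp
qed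

declare type_ring.finite_extension.simps [simp del]

lemma ex_galois_extension:
  assumes K: "number_field (K :: 'a::{alg_closed_field, field_char_0} set)"
  shows "\<exists>L. K \<subseteq> L \<and> galois_number_field L"
proof -
  interpret K: number_field_setup K by unfold_locales (rule K)
  obtain B where B: "finite B" "B \<subseteq> K" "K \<subseteq> rat_space.span B"
    using K unfolding number_field_def by (metis finite_dimension_rat_span)
  have "\<forall>b\<in>B. \<exists>p. p \<noteq> 0 \<and> poly (map_poly of_int p) b = 0"
    using B(2) K.K_algebraic algebraicE' by (metis subsetD)
  then obtain p :: "'a \<Rightarrow> int poly"
    where p: "\<And>b. b \<in> B \<Longrightarrow> p b \<noteq> 0" "\<And>b. b \<in> B \<Longrightarrow> poly (map_poly of_int (p b)) b = 0"
    by metis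
  define Z where "Z = (\<Union>b\<in>B. {z::'a. poly (map_poly of_int (p b)) z = 0})"
  have "finite Z" unfolding Z_def using B(1) p(1) by (intro finite_UN_I poly_roots_finite) auto
  then obtain rs where rs: "set rs = Z" using finite_list by blast
  define L where "L = type_ring.finite_extension \<rat> rs"
  have Z_alg: "algebraic z" if z: "z \<in> Z" for z
  proof -
    obtain b where b: "b \<in> B" "poly (map_poly of_int (p b)) z = 0" using z by (auto simp: Z_def)
    show ?thesis
      by (rule algebraicI[of "map_poly of_int (p b)"]) (use b p in \<open>auto simp: coeff_map_poly\<close>)
  qed
  have subL: "subfield L ring_of_type_algebra" and finL: "type_ring.finite_dimension \<rat> L"
    unfolding L_def
    by (rule type_ring.finite_extension_is_subfield[OF subfield_Rats]
        type_ring.finite_extension_finite_dimension[OF subfield_Rats];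
      use rs Z_alg type_ring_algebraicI in auto)+
  then have L: "number_field L" by (simp add: number_field_def)
  interpret L: number_field_setup L by unfold_locales (rule L)
  have ZL: "Z \<subseteq> L"
    unfolding L_def using type_ring.finite_extension_mem[OF subfieldE(1)[OF subfield_Rats], of rs] rs
    by simp
  have BL: "B \<subseteq> L" using p(2) ZL by (auto simp: Z_def)
  have "x \<in> L" if "x \<in> rat_space.span B" for x
    using that
    by (induction rule: rat_space.span_induct_alt) (use BL L.K_closed L.K_of_rat in auto)
  then have KL: "K \<subseteq> L" using B(3) by auto
  have conj: "y \<in> L" if f: "Factorial_Ring.irreducible f" "poly (map_poly of_rat f) x = 0"
      "poly (map_poly of_rat f) y = 0" and x: "x \<in> L" for f :: "rat poly" and x y
  proof -
    interpret Q: field_embedding \<rat> "\<lambda>x. x :: 'a"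
      by (rule field_embedding.intro) (simp_all add: subfield_Rats)
    have xalg: "algebraic x" using x by (rule L.K_algebraic)
    have root: "poly (map_poly (\<lambda>x. x) g) y = 0" if g: "Q.over_F g" "poly g x = 0" for g
    proof -
      obtain h where h: "g = map_poly of_rat h"
        using g(1) ratpolyE unfolding Q.over_F_def by metis
      then have "f dvd h" using irreducible_dvd_if_common_root[OF f(1,2)] g(2) by simp
      then obtain k where "h = f * k" by blast
      then have "poly g y = 0" using f(3) h by (simp add: map_poly_of_rat_mult)
      then show ?thesis by simp
    qed
    obtain \<phi> where \<phi>: "field_embedding (type_ring.simple_extension \<rat> x) \<phi>" "\<phi> x = y"
      using Q.extend_simple[OF xalg type_ring_algebraicI[OF xalg] root] by blast
    let ?F = "type_ring.simple_extension \<rat> x"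
    interpret F: field_embedding ?F \<phi> by (rule \<phi>)
    let ?M = "type_ring.finite_extension ?F rs"
    obtain \<psi> where \<psi>: "field_embedding ?M \<psi>" "\<And>x. x \<in> ?F \<Longrightarrow> \<psi> x = \<phi> x"
      using F.extend_finite[of rs] rs Z_alg by auto
    interpret M: field_embedding ?M \<psi> by (rule \<psi>)
    have "x \<in> ?F"
      by (rule type_ring.simple_extension_mem[OF subfieldE(1)[OF subfield_Rats]]) simp
    then have "\<psi> x = y" using \<psi>(2) \<phi>(2) by simp
    have "Z \<subseteq> ?M"
      using type_ring.finite_extension_mem[OF subfieldE(1)[OF F.subfield], of rs] rs by simp
    have \<psi>Z: "\<psi> z \<in> Z" if z: "z \<in> Z" for z
    proof -
      obtain b where b: "b \<in> B" "poly (map_poly of_int (p b)) z = 0" using z by (auto simp: Z_def)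
      have "M.over_F (map_poly of_int (p b))" 
        unfolding M.over_F_def by (metis coeff_map_poly M.F_of_int of_int_0)
      then have "\<psi> (poly (map_poly of_int (p b)) z) = poly (map_poly \<psi> (map_poly of_int (p b))) (\<psi> z)"
        using z \<open>Z \<subseteq> ?M\<close> by (intro M.hom_poly) auto
      moreover have "map_poly \<psi> (map_poly of_int (p b)) = map_poly of_int (p b)"
        by (intro poly_eqI) (simp add: M.coeff_map_hom coeff_map_poly M.hom_of_int)
      ultimately show ?thesis using b M.hom_zero by (auto simp: Z_def)
    qed
    define N where "N = {z \<in> ?M. \<psi> z \<in> L}"
    have "subring N ring_of_type_algebra"
      by (rule type_ring.subringI)
        (auto simp: N_def M.hom_one M.hom_minus M.hom_mult M.hom_add intro: M.F_closed L.K_closed)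
    moreover have "\<rat> \<subseteq> N"
    proof
      fix z :: 'a assume z: "z \<in> \<rat>"
      then obtain a b :: int where ab: "b \<noteq> 0" "z = of_int a / of_int b"
        by (metis Rats_cases' less_irrefl)
      have zM: "z \<in> ?M" using M.Rats_subset_F z by blast
      have "\<psi> z * of_int b = of_int a"
        using M.hom_mult[OF zM M.F_of_int[of b]] ab by (simp add: M.hom_of_int)
      then have "\<psi> z = of_int a / of_int b" using ab(1) by (simp add: nonzero_eq_divide_eq)
      then have "\<psi> z = z" using ab(2) by metis
      then show "z \<in> N" using zM ab L.K_divide L.K_of_int by (simp add: N_def)
    qed
    moreover have "set rs \<subseteq> N" using rs \<open>Z \<subseteq> ?M\<close> \<psi>Z ZL by (auto simp: N_def)
    ultimately have "L \<subseteq> N" unfolding L_def by (rule type_ring.finite_extension_subring_incl)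
    then show ?thesis using x \<open>\<psi> x = y\<close> by (auto simp: N_def)
  qed
  have "\<exists>A. finite A \<and> A \<subseteq> L \<and> map_poly of_rat f =
      Polynomial.smult (of_rat (lead_coeff f)) (\<Prod>a\<in>A. [:- a, 1:])"
    if f: "Factorial_Ring.irreducible f" and x: "x \<in> L" "poly (map_poly of_rat f) x = 0"
    for f :: "rat poly" and x
  proof (intro exI conjI)
    have "f \<noteq> 0" using f by auto
    then show "finite {a::'a. poly (map_poly of_rat f) a = 0}" by (intro poly_roots_finite) auto
    show "{a. poly (map_poly of_rat f) a = 0} \<subseteq> L" using conj[OF f x(2)] x(1) by auto
  qed (rule irreducible_rat_poly_splits[OF f])
  then have "galois_number_field L" using L unfolding galois_number_field_def by blast
  then show ?thesis using KL by blast
qed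

section \<open>The valuation at a prime ideal\<close>

locale number_field_prime = number_field_setup +
  fixes P :: "'a set"
  assumes nonzero_prime: "P \<in> nonzero_primes K"
begin

abbreviation R :: "'a ring" where "R \<equiv> ring_of_integers K"

lemma R_simps [simp]:
  "x \<otimes>\<^bsub>R\<^esub> y = x * y" "x \<oplus>\<^bsub>R\<^esub> y = x + y" "\<zero>\<^bsub>R\<^esub> = 0" "\<one>\<^bsub>R\<^esub> = 1"
  by (simp_all add: ring_of_integers_def ring_of_type_algebra_def)

lemma primeideal_P: "primeideal P R" and P_nonzero: "P \<noteq> {0}"
  using nonzero_prime by (auto simp: nonzero_primes_def)

lemma ideal_P: "ideal P R"
  using primeideal_P by (rule primeideal.axioms(1))

lemma ring_R: "ring R"
  using ideal_P by (rule ideal.axioms(2))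

lemma ideal_closed:
  assumes "ideal I R"
  shows "x \<in> I \<Longrightarrow> x \<in> \<O>" and "0 \<in> I"
    and "x \<in> I \<Longrightarrow> y \<in> I \<Longrightarrow> x + y \<in> I"
    and "a \<in> \<O> \<Longrightarrow> x \<in> I \<Longrightarrow> a * x \<in> I"
  using ideal.Icarr[OF assms, of x] ideal.I_l_closed[OF assms, of x a]
    additive_subgroup.zero_closed[OF ideal.axioms(1)[OF assms]]
    additive_subgroup.a_closed[OF ideal.axioms(1)[OF assms], of x y]
  by simp_all

lemma ideal_diff:
  assumes "ideal I R" "x \<in> I" "y \<in> I"
  shows "x - y \<in> I"
proof -
  have "(- 1) * y \<in> I" using assms ints_intros by (intro ideal_closed(4)) auto
  then show ?thesis using ideal_closed(3)[OF assms(1,2), of "(- 1) * y"] by simp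
qed

lemmas P_closed = ideal_closed[OF ideal_P]
lemmas P_diff = ideal_diff[OF ideal_P]

lemma one_notin_P: "1 \<notin> P"
proof
  assume "1 \<in> P"
  then have "P = \<O>" using P_closed(1) P_closed(4)[of _ 1] by auto
  then show False using primeideal.I_notcarr[OF primeideal_P] by simp
qed

lemma P_prime: "a \<in> \<O> \<Longrightarrow> b \<in> \<O> \<Longrightarrow> a * b \<in> P \<Longrightarrow> a \<in> P \<or> b \<in> P"
  using primeideal.I_prime[OF primeideal_P, of a b] by simp

lemma notin_P_mult:
  "a \<in> \<O> \<Longrightarrow> a \<notin> P \<Longrightarrow> b \<in> \<O> \<Longrightarrow> b \<notin> P \<Longrightarrow> a * b \<in> \<O> \<and> a * b \<notin> P"
  using P_prime ints_mult by blast

lemma notin_P_power: "a \<in> \<O> \<Longrightarrow> a \<notin> P \<Longrightarrow> a ^ n \<in> \<O> \<and> a ^ n \<notin> P"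
  by (induction n) (use one_notin_P ints_one notin_P_mult in auto)

lemma P_power: "x \<in> P \<Longrightarrow> n > 0 \<Longrightarrow> x ^ n \<in> P"
  by (cases n) (auto simp: power_Suc2 simp del: power_Suc intro: P_closed(4) ints_power P_closed(1))

lemma ex1_prime_in_P: "\<exists>!q. Factorial_Ring.prime q \<and> of_nat q \<in> P"
proof -
  obtain a where a: "a \<in> P" "a \<noteq> 0" using P_nonzero P_closed(2) by blast
  obtain b and m :: int where b: "b \<in> \<O>" "m \<noteq> 0" "a * b = of_int m"
    using ints_dvd_integer[OF P_closed(1)[OF a(1)] a(2)] .
  have m: "of_int m \<in> P" using P_closed(4)[OF b(1) a(1)] b(3) by (simp add: mult.commute)
  have "of_int \<bar>m\<bar> \<in> P"
    using m P_diff[OF P_closed(2) m] by (simp add: abs_if)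
  then have mn: "of_nat (nat \<bar>m\<bar>) \<in> P" by simp
  have ex: "\<exists>q. Factorial_Ring.prime q \<and> of_nat q \<in> P" if "n > 0" "of_nat n \<in> P" for n
    using that
  proof (induction n rule: less_induct)
    case (less n)
    have "n \<noteq> 1" using less.prems one_notin_P by auto
    then obtain r where r: "Factorial_Ring.prime r" "r dvd n" using prime_factor_nat by blast
    then obtain k where k: "n = r * k" by blast
    have "of_nat r * of_nat k \<in> P" using less.prems k by simp
    then consider "of_nat r \<in> P" | "of_nat k \<in> P" using P_prime ints_of_nat by blast
    then show ?case
    proof cases
      case 2
      have "k < n" using k r less.prems prime_gt_1_nat[of r] by auto
      moreover have "k > 0" using k less.prems by auto
      ultimately show ?thesis using 2 less.IH by blast
    qed (use r in blast)
  qed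
  have "p = q" if p: "Factorial_Ring.prime p" "of_nat p \<in> P"
    and q: "Factorial_Ring.prime q" "of_nat q \<in> P" for p q
  proof (rule ccontr)
    assume "p \<noteq> q"
    then have "coprime (int p) (int q)" using p q by (simp add: primes_coprime)
    then obtain a b where ab: "a * int p + b * int q = 1"
      using bezout_int[of "int p" "int q"] by (metis coprime_iff_gcd_eq_1)
    have "of_int a * of_nat p + of_int b * of_nat q \<in> P"
      using p q ints_of_int by (intro P_closed(3,4)) auto
    moreover have "of_int a * of_nat p + of_int b * of_nat q = (1::'a)"
      using arg_cong[OF ab, of "of_int :: int \<Rightarrow> 'a"] by simp
    ultimately show False using one_notin_P by simp
  qed
  then show ?thesis using ex[OF _ mn] b(2) by auto
qed

abbreviation q :: nat where "q \<equiv> prime_below P"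

lemma prime_q: "Factorial_Ring.prime q" and q_in_P: "of_nat q \<in> P"
  using theI'[OF ex1_prime_in_P] by (simp_all add: prime_below_def)

lemma prime_below_eqI: "Factorial_Ring.prime p \<Longrightarrow> of_nat p \<in> P \<Longrightarrow> q = p"
  using ex1_prime_in_P prime_q q_in_P by blast

lemma q_nonzero: "of_nat q \<noteq> (0::'a)"
  using prime_q by auto

lemma of_int_notin_P:
  assumes "\<not> int q dvd m"
  shows "of_int m \<notin> P"
proof
  assume m: "of_int m \<in> P"
  have "coprime (int q) m" using prime_q assms by (simp add: prime_imp_coprime)
  then obtain a b where ab: "a * int q + b * m = 1"
    using bezout_int[of "int q" m] by (metis coprime_iff_gcd_eq_1)
  have "of_int a * of_nat q + of_int b * of_int m \<in> P"
    using m q_in_P ints_of_int by (intro P_closed(3,4)) auto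
  moreover have "of_int a * of_nat q + of_int b * of_int m = (1::'a)"
    using arg_cong[OF ab, of "of_int :: int \<Rightarrow> 'a"] by simp
  ultimately show False using one_notin_P by simp
qed

lemma power_pigeonhole:
  assumes "x \<in> \<O>"
  obtains i j y where "i < j" "y \<in> \<O>" "x ^ i - x ^ j = of_nat q * y"
proof -
  obtain B where B: "finite B" "\<And>x. x \<in> \<O> \<Longrightarrow> \<exists>b\<in>B. \<exists>y\<in>\<O>. x = b + of_nat q * y"
    using finite_residues[OF prime_q] by blast
  have "\<forall>i. \<exists>b y. b \<in> B \<and> y \<in> \<O> \<and> x ^ i = b + of_nat q * y"
    using B(2) ints_power[OF assms] by blast
  then obtain f g where fg: "\<And>i. f i \<in> B" "\<And>i. g i \<in> \<O>" "\<And>i. x ^ i = f i + of_nat q * g i"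
    by metis
  have "\<not> inj f"
    using B(1) fg(1) by (meson finite_subset image_subsetI infinite_UNIV_nat finite_imageD)
  then obtain i j where "f i = f j" "i \<noteq> j" by (auto simp: inj_def)
  then obtain i j where ij: "f i = f j" "i < j" by (metis nat_neq_iff)
  have "x ^ i - x ^ j = of_nat q * (g i - g j)"
    unfolding fg(3) ij(1) by (simp add: algebra_simps)
  then show ?thesis using that ij(2) ints_diff fg(2) by blast
qed

lemma inverse_mod_P:
  assumes u: "u \<in> \<O>" "u \<notin> P"
  obtains w where "w \<in> \<O>" "1 - u * w \<in> P"
proof -
  obtain i j y where ij: "i < j" "y \<in> \<O>" "u ^ i - u ^ j = of_nat q * y"
    using power_pigeonhole[OF u(1)] .
  have "u ^ j = u ^ i * u ^ (j - i)" using ij(1) by (metis less_imp_add_positive add_diff_cancel_left' power_add)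
  then have "u ^ i * (1 - u ^ (j - i)) = y * of_nat q" using ij(3) by (simp add: algebra_simps)
  moreover have "y * of_nat q \<in> P" using ij(2) q_in_P by (rule P_closed(4))
  ultimately have "u ^ i * (1 - u ^ (j - i)) \<in> P" by simp
  then have "1 - u ^ (j - i) \<in> P"
    using P_prime[of "u ^ i" "1 - u ^ (j - i)"] notin_P_power[OF u] ints_diff[OF ints_one] by blast
  moreover have "u ^ (j - i) = u * u ^ (j - i - 1)"
    using ij(1) by (metis Suc_diff_1 power_Suc zero_less_diff)
  ultimately show ?thesis using that ints_power[OF u(1)] by metis
qed

text \<open>The elements of \<open>\<O>\<close> that become multiples of \<open>q\<close> in the localization at \<open>P\<close>.\<close>
definition locally_dvd :: "'a set" where
  "locally_dvd = {x \<in> \<O>. \<exists>s\<in>\<O>. s \<notin> P \<and> (\<exists>y\<in>\<O>. s * x = of_nat q * y)}"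

lemma locally_dvd_mult: "a \<in> \<O> \<Longrightarrow> x \<in> locally_dvd \<Longrightarrow> a * x \<in> locally_dvd"
proof -
  assume a: "a \<in> \<O>" and "x \<in> locally_dvd"
  then obtain s y where s: "x \<in> \<O>" "s \<in> \<O>" "s \<notin> P" "y \<in> \<O>" "s * x = of_nat q * y"
    by (auto simp: locally_dvd_def)
  have "s * (a * x) = of_nat q * (a * y)" using s(5) by (simp add: mult.left_commute)
  then show ?thesis using s a ints_mult unfolding locally_dvd_def by blast
qed

lemma one_notin_locally_dvd: "1 \<notin> locally_dvd"
proof
  assume "1 \<in> locally_dvd"
  then obtain s y where s: "s \<in> \<O>" "s \<notin> P" "y \<in> \<O>" "s * 1 = of_nat q * y"
    by (auto simp: locally_dvd_def)
  then show False using P_closed(4)[OF s(3) q_in_P] by (simp add: mult.commute)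
qed

lemma power_locally_dvd:
  assumes x: "x \<in> P"
  obtains n where "x ^ n \<in> locally_dvd"
proof -
  obtain i j y where ij: "i < j" "y \<in> \<O>" "x ^ i - x ^ j = of_nat q * y"
    using power_pigeonhole[OF P_closed(1)[OF x]] .
  have "x ^ j = x ^ i * x ^ (j - i)" using ij(1) by (metis less_imp_add_positive add_diff_cancel_left' power_add)
  then have "(1 - x ^ (j - i)) * x ^ i = of_nat q * y" using ij(3) by (simp add: algebra_simps)
  moreover have "1 - x ^ (j - i) \<notin> P"
  proof
    assume "1 - x ^ (j - i) \<in> P"
    then have "(1 - x ^ (j - i)) + x ^ (j - i) \<in> P"
      by (intro P_closed(3) P_power) (use x ij in auto)
    then show False using one_notin_P by simp
  qed
  moreover have "1 - x ^ (j - i) \<in> \<O>" "x ^ i \<in> \<O>"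
    using P_closed(1)[OF x] by (auto intro: ints_intros)
  ultimately have "x ^ i \<in> locally_dvd" using ij(2) unfolding locally_dvd_def by blast
  then show ?thesis by (rule that)
qed

lemma ex_locally_annihilating:
  assumes "finite G" "G \<subseteq> P"
  shows "\<exists>b\<in>\<O>. b \<notin> locally_dvd \<and> (\<forall>x\<in>G. b * x \<in> locally_dvd)"
  using assms
proof (induction rule: finite_induct)
  case empty
  then show ?case using ints_one one_notin_locally_dvd by auto
next
  case (insert x G)
  then obtain b where b: "b \<in> \<O>" "b \<notin> locally_dvd" "\<And>y. y \<in> G \<Longrightarrow> b * y \<in> locally_dvd" by auto
  have x: "x \<in> P" "x \<in> \<O>" using insert.prems P_closed(1) by auto
  obtain n where "x ^ n \<in> locally_dvd" using power_locally_dvd[OF x(1)] .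
  then have ex: "b * x ^ n \<in> locally_dvd" using b(1) locally_dvd_mult by blast
  define n where "n = (LEAST n. b * x ^ n \<in> locally_dvd)"
  have n: "b * x ^ n \<in> locally_dvd" unfolding n_def using ex by (rule LeastI)
  have "n \<noteq> 0" using n b(2) by (cases n) auto
  then obtain k where k: "n = Suc k" by (cases n) auto
  have "b * x ^ k \<notin> locally_dvd" using not_less_Least[of k "\<lambda>n. b * x ^ n \<in> locally_dvd"] k
    by (simp add: n_def)
  moreover have "b * x ^ k \<in> \<O>" using b x by (intro ints_intros)
  moreover have "(b * x ^ k) * y \<in> locally_dvd" if "y \<in> insert x G" for y
  proof (cases "y = x")
    case True
    then show ?thesis using n k by (simp add: mult.assoc power_commutes)
  next
    case False
    then show ?thesis using locally_dvd_mult[OF ints_power[OF x(2), of k] b(3)[of y]] that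
      by (simp add: mult_ac)
  qed
  ultimately show ?case by blast
qed

lemma ex_common_denominator:
  assumes "finite G" "\<And>x. x \<in> G \<Longrightarrow> h x \<in> locally_dvd"
  shows "\<exists>s\<in>\<O>. s \<notin> P \<and> (\<forall>x\<in>G. \<exists>y\<in>\<O>. s * h x = of_nat q * y)"
  using assms
proof (induction rule: finite_induct)
  case empty
  then show ?case using ints_one one_notin_P by auto
next
  case (insert x G)
  then obtain s where s: "s \<in> \<O>" "s \<notin> P" "\<And>z. z \<in> G \<Longrightarrow> \<exists>y\<in>\<O>. s * h z = of_nat q * y" by auto
  have "h x \<in> locally_dvd" using insert.prems by simp
  then obtain t y where t: "t \<in> \<O>" "t \<notin> P" "y \<in> \<O>" "t * h x = of_nat q * y"
    by (auto simp: locally_dvd_def)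
  have "\<exists>y\<in>\<O>. (s * t) * h z = of_nat q * y" if z: "z \<in> insert x G" for z
  proof (cases "z = x")
    case True
    have "(s * t) * h z = of_nat q * (s * y)" using True t by (simp add: mult_ac)
    then show ?thesis using s t ints_mult by blast
  next
    case False
    then obtain y' where y': "y' \<in> \<O>" "s * h z = of_nat q * y'" using s(3) z by blast
    have "(s * t) * h z = t * (s * h z)" by (simp add: mult_ac)
    also have "\<dots> = of_nat q * (t * y')" unfolding y'(2) by (simp add: mult_ac)
    finally show ?thesis using y'(1) t(1) ints_mult by blast
  qed
  then show ?case using notin_P_mult[OF s(1,2) t(1,2)] by blast
qed

text \<open>
  An element \<open>c\<close> with \<open>c P \<subseteq> \<O>\<close> and \<open>c P\<close> not contained in \<open>P\<close> makes the localization at \<open>P\<close>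
  a discrete valuation ring. It is found as \<open>s b / q\<close>, where \<open>b\<close> is nonzero in the socle of the
  localization of the finite ring \<open>\<O> / q\<O>\<close>; if \<open>c P \<subseteq> P\<close>, then \<open>c\<close> would be integral.
\<close>
lemma ex_local_inverse: "\<exists>c\<in>K. (\<forall>x\<in>P. c * x \<in> \<O>) \<and> (\<exists>x\<in>P. c * x \<notin> P)"
proof -
  obtain B where B: "finite B" "\<And>x. x \<in> \<O> \<Longrightarrow> \<exists>b\<in>B. \<exists>y\<in>\<O>. x = b + of_nat q * y"
    using finite_residues[OF prime_q] by blast
  define F where "F = B \<inter> P"
  have F: "\<exists>f\<in>F. \<exists>y\<in>\<O>. x = f + of_nat q * y" if x: "x \<in> P" for x
  proof -
    obtain b y where b: "b \<in> B" "y \<in> \<O>" "x = b + of_nat q * y" using B(2) P_closed(1)[OF x] by blast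
    have "b = x - y * of_nat q" using b by simp
    then have "b \<in> P" using P_diff[OF x P_closed(4)[OF b(2) q_in_P]] by simp
    then show ?thesis using b by (auto simp: F_def)
  qed
  have finF: "finite F" "F \<subseteq> P" using B(1) by (auto simp: F_def)
  obtain b where b: "b \<in> \<O>" "b \<notin> locally_dvd" "\<And>x. x \<in> F \<Longrightarrow> b * x \<in> locally_dvd"
    using ex_locally_annihilating[OF finF] by blast
  obtain s where s: "s \<in> \<O>" "s \<notin> P" "\<And>x. x \<in> F \<Longrightarrow> \<exists>y\<in>\<O>. s * (b * x) = of_nat q * y"
    using ex_common_denominator[OF finF(1), of "\<lambda>x. b * x"] b(3) by blast
  define c where "c = s * b / of_nat q"
  have cK: "c \<in> K" using s b K_of_nat by (auto simp: c_def ints_iff intro!: K_divide K_closed)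
  have cO: "c * x \<in> \<O>" if x: "x \<in> P" for x
  proof -
    obtain f y where f: "f \<in> F" "y \<in> \<O>" "x = f + of_nat q * y" using F[OF x] by blast
    obtain z where z: "z \<in> \<O>" "s * (b * f) = of_nat q * z" using s(3)[OF f(1)] by blast
    have "s * b * x = of_nat q * (z + s * b * y)" using z(2) f(3) by (simp add: algebra_simps)
    then have "c * x = z + s * b * y" using q_nonzero by (simp add: c_def field_simps)
    then show ?thesis using z s b f by (auto intro: ints_intros)
  qed
  have "\<exists>x\<in>P. c * x \<notin> P"
  proof (rule ccontr)
    assume "\<not> ?thesis"
    then have stable: "c * x \<in> P" if "x \<in> P" for x using that by blast
    define V where "V = insert (of_nat q) F"
    have V: "finite V" "V \<subseteq> P" using finF q_in_P by (auto simp: V_def)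
    have "\<forall>v\<in>V. \<exists>f y. f \<in> F \<and> y \<in> \<O> \<and> c * v = f + of_nat q * y"
      using F stable V by blast
    then obtain f y where fy: "\<And>v. v \<in> V \<Longrightarrow> f v \<in> F" "\<And>v. v \<in> V \<Longrightarrow> y v \<in> \<O>"
      "\<And>v. v \<in> V \<Longrightarrow> c * v = f v + of_nat q * y v" by metis
    define a where "a v w = (if w = f v then 1 else 0) + (if w = of_nat q then y v else 0)" for v w
    have "algebraic_int c"
    proof (rule algebraic_int_if_stable_module[OF V(1)])
      show "of_nat q \<in> V" by (simp add: V_def)
      show "of_nat q \<noteq> (0::'a)" by (rule q_nonzero)
      fix v assume v: "v \<in> V"
      have fv: "f v \<in> V" using fy(1)[OF v] by (simp add: V_def)
      have "(\<Sum>w\<in>V. a v w * w) = (\<Sum>w\<in>V. (if w = f v then w else 0) + (if w = of_nat q then y v * w else 0))"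
        by (intro sum.cong) (auto simp: a_def algebra_simps)
      also have "\<dots> = f v + y v * of_nat q"
        using V(1) fv by (simp add: sum.distrib sum.delta V_def)
      finally show "c * v = (\<Sum>w\<in>V. a v w * w)" using fy(3)[OF v] by (simp add: mult.commute)
      fix w assume "w \<in> V"
      have "a v w \<in> \<O>" using fy(2)[OF v] by (auto simp: a_def intro: ints_intros)
      then show "algebraic_int (a v w)" by (simp add: ints_iff)
    qed
    then have "c \<in> \<O>" using cK by (simp add: ints_iff)
    moreover have "s * b = of_nat q * c" using q_nonzero by (simp add: c_def)
    ultimately have "b \<in> locally_dvd" using s b(1) unfolding locally_dvd_def by blast
    then show False using b(2) by blast
  qed
  then show ?thesis using cK cO by blast
qed

definition local_inverse :: 'a ("\<gamma>") where
  "\<gamma> = (SOME c. c \<in> K \<and> (\<forall>x\<in>P. c * x \<in> \<O>) \<and> (\<exists>x\<in>P. c * x \<notin> P))"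

definition uniformizer :: 'a ("\<pi>") where
  "\<pi> = (SOME x. x \<in> P \<and> \<gamma> * x \<notin> P)"

lemma gamma_in_K: "\<gamma> \<in> K" and gamma_mult_P: "\<And>x. x \<in> P \<Longrightarrow> \<gamma> * x \<in> \<O>"
  and pi_in_P: "\<pi> \<in> P" and gamma_pi_notin: "\<gamma> * \<pi> \<notin> P"
proof -
  have g: "\<gamma> \<in> K \<and> (\<forall>x\<in>P. \<gamma> * x \<in> \<O>) \<and> (\<exists>x\<in>P. \<gamma> * x \<notin> P)"
  proof -
    have "\<exists>c. c \<in> K \<and> (\<forall>x\<in>P. c * x \<in> \<O>) \<and> (\<exists>x\<in>P. c * x \<notin> P)"
      using ex_local_inverse by blast
    then show ?thesis unfolding local_inverse_def by (rule someI_ex)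
  qed
  then show "\<gamma> \<in> K" "\<And>x. x \<in> P \<Longrightarrow> \<gamma> * x \<in> \<O>" by blast+
  have "\<pi> \<in> P \<and> \<gamma> * \<pi> \<notin> P"
  proof -
    have "\<exists>x. x \<in> P \<and> \<gamma> * x \<notin> P" using g by blast
    then show ?thesis unfolding uniformizer_def by (rule someI_ex)
  qed
  then show "\<pi> \<in> P" "\<gamma> * \<pi> \<notin> P" by blast+
qed

lemma gamma_pi_in: "\<gamma> * \<pi> \<in> \<O>"
  using gamma_mult_P pi_in_P by blast

lemma gamma_nonzero: "\<gamma> \<noteq> 0"
  using gamma_pi_notin P_closed(2) by auto

abbreviation P_pow :: "nat \<Rightarrow> 'a set" where
  "P_pow n \<equiv> P [^]\<^bsub>ideals_set R\<^esub> n"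

lemma ideals_set_one [simp]: "\<one>\<^bsub>ideals_set R\<^esub> = \<O>"
  by (simp add: ideals_set_def)

lemma P_pow_0: "P_pow 0 = \<O>" and P_pow_Suc: "P_pow (Suc n) = ideal_prod R (P_pow n) P"
  by (simp_all add: nat_pow_def ideals_set_def)

lemma ideal_P_pow: "ideal (P_pow n) R"
proof (induction n)
  case 0
  show ?case unfolding P_pow_0 by (rule ring.oneideal[OF ring_R])
next
  case (Suc n)
  then show ?case unfolding P_pow_Suc by (intro ring.ideal_prod_is_ideal[OF ring_R] ideal_P)
qed

lemmas P_pow_closed = ideal_closed[OF ideal_P_pow]

lemma P_pow_mult: "a \<in> P_pow n \<Longrightarrow> x \<in> P \<Longrightarrow> a * x \<in> P_pow (Suc n)"
  unfolding P_pow_Suc using ideal_prod.prod[of a "P_pow n" x P R] by simp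

lemma P_pow_antimono: "m \<le> n \<Longrightarrow> P_pow n \<subseteq> P_pow m"
proof (induction rule: dec_induct)
  case (step n)
  then show ?case
    unfolding P_pow_Suc using ring.ideal_prod_inter[OF ring_R ideal_P_pow[of n] ideal_P] by auto
qed simp

lemma power_in_P_pow: "x \<in> P \<Longrightarrow> x ^ n \<in> P_pow n"
proof (induction n)
  case 0
  then show ?case by (simp add: P_pow_0 ints_one)
next
  case (Suc n)
  then show ?case using P_pow_mult[of "x ^ n" n x] by (simp add: mult.commute)
qed

lemma gamma_power_mult: "a \<in> P_pow n \<Longrightarrow> \<gamma> ^ n * a \<in> \<O>"
proof (induction n arbitrary: a)
  case 0
  then show ?case by (simp add: P_pow_0)
next
  case (Suc n)
  from Suc.prems show ?case unfolding P_pow_Suc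
  proof (induction rule: ideal_prod.induct)
    case (prod i j)
    have "(\<gamma> ^ n * i) * (\<gamma> * j) \<in> \<O>" using prod by (intro ints_mult[OF Suc.IH gamma_mult_P])
    then show ?case by (simp add: mult_ac)
  next
    case (sum s t)
    then show ?case using ints_add by (simp add: distrib_left)
  qed
qed

lemma P_pow_cancel:
  assumes u: "u \<in> \<O>" "u \<notin> P" and a: "a \<in> \<O>" "u * a \<in> P_pow n"
  shows "a \<in> P_pow n"
proof -
  obtain w where w: "w \<in> \<O>" "1 - u * w \<in> P" using inverse_mod_P[OF u] .
  have "k \<le> n \<Longrightarrow> a \<in> P_pow k" for k
  proof (induction k)
    case 0
    then show ?case using a by (simp add: P_pow_0)
  next
    case (Suc k)
    have "a * (1 - u * w) \<in> P_pow (Suc k)" using Suc w by (intro P_pow_mult) auto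
    moreover have "w * (u * a) \<in> P_pow (Suc k)"
      using P_pow_closed(4)[OF w(1)] P_pow_antimono[OF Suc.prems] a(2) by blast
    ultimately have "a * (1 - u * w) + w * (u * a) \<in> P_pow (Suc k)" by (rule P_pow_closed(3))
    then show ?case by (simp add: algebra_simps)
  qed
  then show ?thesis by blast
qed

lemma P_pow_iff:
  assumes a: "a \<in> \<O>"
  shows "a \<in> P_pow n \<longleftrightarrow> \<gamma> ^ n * a \<in> \<O>"
proof
  assume g: "\<gamma> ^ n * a \<in> \<O>"
  have "(\<gamma> ^ n * a) * \<pi> ^ n \<in> P_pow n"
    using g power_in_P_pow[OF pi_in_P] by (rule P_pow_closed(4))
  then have "(\<gamma> * \<pi>) ^ n * a \<in> P_pow n" by (simp add: power_mult_distrib mult_ac)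
  then show "a \<in> P_pow n"
    using P_pow_cancel a notin_P_power[OF gamma_pi_in gamma_pi_notin] by blast
qed (rule gamma_power_mult)

definition exact_order :: "'a \<Rightarrow> nat \<Rightarrow> bool" where
  "exact_order a n \<longleftrightarrow> \<gamma> ^ n * a \<in> \<O> \<and> \<gamma> ^ n * a \<notin> P"

lemma exact_order_iff:
  assumes a: "a \<in> \<O>"
  shows "exact_order a n \<longleftrightarrow> a \<in> P_pow n \<and> a \<notin> P_pow (Suc n)"
proof
  assume e: "exact_order a n"
  have "a \<notin> P_pow (Suc n)"
  proof
    assume "a \<in> P_pow (Suc n)"
    then have "\<gamma> ^ Suc n * a \<in> \<O>" by (rule gamma_power_mult)
    then have "(\<gamma> ^ Suc n * a) * \<pi> \<in> P" using pi_in_P by (rule P_closed(4))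
    then have "(\<gamma> * \<pi>) * (\<gamma> ^ n * a) \<in> P" by (simp add: mult_ac)
    then show False using P_prime[OF gamma_pi_in, of "\<gamma> ^ n * a"] e gamma_pi_notin
      by (auto simp: exact_order_def)
  qed
  then show "a \<in> P_pow n \<and> a \<notin> P_pow (Suc n)"
    using e P_pow_iff[OF a] by (auto simp: exact_order_def)
next
  assume r: "a \<in> P_pow n \<and> a \<notin> P_pow (Suc n)"
  then have "\<gamma> ^ n * a \<in> \<O>" using P_pow_iff[OF a] by blast
  moreover have "\<gamma> ^ n * a \<notin> P"
  proof
    assume "\<gamma> ^ n * a \<in> P"
    then have "\<gamma> * (\<gamma> ^ n * a) \<in> \<O>" by (rule gamma_mult_P)
    then show False using r P_pow_iff[OF a, of "Suc n"] by (simp add: mult.assoc)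
  qed
  ultimately show "exact_order a n" by (simp add: exact_order_def)
qed

lemma exact_order_mult: "exact_order a m \<Longrightarrow> exact_order b n \<Longrightarrow> exact_order (a * b) (m + n)"
  unfolding exact_order_def using notin_P_mult[of "\<gamma> ^ m * a" "\<gamma> ^ n * b"]
  by (simp add: power_add mult_ac)

lemma exact_order_power: "exact_order a m \<Longrightarrow> exact_order (a ^ n) (n * m)"
proof (induction n)
  case 0
  then show ?case using ints_one one_notin_P by (simp add: exact_order_def)
next
  case (Suc n)
  then show ?case using exact_order_mult[of a m "a ^ n" "n * m"] by simp
qed

lemma ex_exact_order_if_notin:
  assumes "a \<in> \<O>" "a \<notin> P_pow n"
  shows "\<exists>k. exact_order a k"
proof -
  define m where "m = (LEAST n. a \<notin> P_pow n)"
  have m: "a \<notin> P_pow m" unfolding m_def using assms(2) by (rule LeastI)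
  have "m \<noteq> 0" using m assms(1) by (intro notI) (simp add: P_pow_0)
  then obtain k where k: "m = Suc k" by (cases m) auto
  have "a \<in> P_pow k" using not_less_Least[of k "\<lambda>n. a \<notin> P_pow n"] k by (simp add: m_def)
  then show ?thesis using m k exact_order_iff[OF assms(1)] by auto
qed

lemma ex_exact_order_q: "\<exists>k. exact_order (of_nat q) k"
proof -
  obtain i j y where ij: "i < j" "y \<in> \<O>" "\<pi> ^ i - \<pi> ^ j = of_nat q * y"
    using power_pigeonhole[OF P_closed(1)[OF pi_in_P]] .
  have "exact_order (\<pi> ^ i) i"
    using notin_P_power[OF gamma_pi_in gamma_pi_notin, of i]
    by (simp add: exact_order_def power_mult_distrib)
  then have pi: "\<pi> ^ i \<notin> P_pow (Suc i)"
    using exact_order_iff ints_power P_closed(1) pi_in_P by blast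
  have "of_nat q \<notin> P_pow (Suc i)"
  proof
    assume "of_nat q \<in> P_pow (Suc i)"
    then have "y * of_nat q \<in> P_pow (Suc i)" using ij(2) by (intro P_pow_closed(4))
    moreover have "\<pi> ^ j \<in> P_pow (Suc i)"
      using power_in_P_pow[OF pi_in_P, of j] P_pow_antimono[of "Suc i" j] ij(1) by auto
    ultimately have "y * of_nat q + \<pi> ^ j \<in> P_pow (Suc i)" by (rule P_pow_closed(3))
    moreover have "\<pi> ^ i = y * of_nat q + \<pi> ^ j" using ij(3) by (simp add: algebra_simps)
    ultimately show False using pi by simp
  qed
  then show ?thesis using ex_exact_order_if_notin ints_of_nat by blast
qed

lemma ex_exact_order:
  assumes a: "a \<in> \<O>" "a \<noteq> 0"
  shows "\<exists>k. exact_order a k"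
proof -
  obtain b and m :: int where b: "b \<in> \<O>" "m \<noteq> 0" "a * b = of_int m"
    using ints_dvd_integer[OF a] .
  have "\<not> is_unit (int q)" using prime_q not_prime_unit prime_nat_int_transfer by blast
  then obtain m' where m': "m = int q ^ multiplicity (int q) m * m'" "\<not> int q dvd m'"
    using multiplicity_decompose'[OF b(2)] by metis
  define k where "k = multiplicity (int q) m"
  obtain e where e: "exact_order (of_nat q) e" using ex_exact_order_q by blast
  have "exact_order (of_int m') 0"
    using of_int_notin_P[OF m'(2)] ints_of_int by (simp add: exact_order_def)
  then have "exact_order (of_nat q ^ k * of_int m') (k * e + 0)"
    by (intro exact_order_mult exact_order_power e)
  moreover have "of_int m = (of_nat q ^ k * of_int m' :: 'a)"
    using m'(1) unfolding k_def by (metis of_int_mult of_int_of_nat_eq of_int_power)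
  ultimately have "exact_order (of_int m) (k * e)" by simp
  then have "b * a \<notin> P_pow (Suc (k * e))"
    using exact_order_iff[OF ints_of_int] b(3) by (simp add: mult.commute)
  then have "a \<notin> P_pow (Suc (k * e))" using P_pow_closed(4)[OF b(1)] by blast
  then show ?thesis using ex_exact_order_if_notin a by blast
qed

lemma int_ord_eqI:
  assumes "a \<in> \<O>" "exact_order a n"
  shows "int_ord K P a = n"
  unfolding int_ord_def
proof (rule Greatest_equality)
  have a: "a \<in> P_pow n" "a \<notin> P_pow (Suc n)" using assms exact_order_iff by auto
  then show "a \<in> P_pow n" by simp
  show "k \<le> n" if "a \<in> P_pow k" for k
    using a(2) that P_pow_antimono[of "Suc n" k] by (meson not_less_eq_eq subsetD)
qed

lemma exact_order_int_ord: "a \<in> \<O> \<Longrightarrow> a \<noteq> 0 \<Longrightarrow> exact_order a (int_ord K P a)"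
  using ex_exact_order int_ord_eqI by metis

lemma int_ord_mult:
  assumes "a \<in> \<O>" "a \<noteq> 0" "b \<in> \<O>" "b \<noteq> 0"
  shows "int_ord K P (a * b) = int_ord K P a + int_ord K P b"
  using assms by (intro int_ord_eqI ints_mult exact_order_mult exact_order_int_ord)

lemma P_pow_iff_int_ord:
  assumes "a \<in> \<O>" "a \<noteq> 0"
  shows "a \<in> P_pow n \<longleftrightarrow> n \<le> int_ord K P a"
proof -
  have "a \<in> P_pow (int_ord K P a)" "a \<notin> P_pow (Suc (int_ord K P a))"
    using exact_order_int_ord[OF assms] exact_order_iff[OF assms(1)] by auto
  then show ?thesis
    using P_pow_antimono[of n "int_ord K P a"] P_pow_antimono[of "Suc (int_ord K P a)" n]
    by (meson not_less_eq_eq subsetD)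
qed

lemma int_ord_add:
  assumes "a \<in> \<O>" "a \<noteq> 0" "b \<in> \<O>" "b \<noteq> 0" "a + b \<noteq> 0"
  shows "min (int_ord K P a) (int_ord K P b) \<le> int_ord K P (a + b)"
proof -
  let ?n = "min (int_ord K P a) (int_ord K P b)"
  have "a \<in> P_pow ?n" "b \<in> P_pow ?n"
    using assms by (simp_all add: P_pow_iff_int_ord)
  then have "a + b \<in> P_pow ?n" by (rule P_pow_closed(3))
  then show ?thesis using assms ints_add P_pow_iff_int_ord by blast
qed

lemma field_ord_divide_ints:
  assumes "a \<in> \<O>" "a \<noteq> 0" "b \<in> \<O>" "b \<noteq> 0"
  shows "field_ord K P (a / b) = int (int_ord K P a) - int (int_ord K P b)"
  unfolding field_ord_def
proof (rule the_equality)
  show "\<exists>a'\<in>\<O> - {0}. \<exists>b'\<in>\<O> - {0}. a / b = a' / b' \<and>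
      int (int_ord K P a) - int (int_ord K P b) = int (int_ord K P a') - int (int_ord K P b')"
    using assms by blast
next
  fix k assume "\<exists>a'\<in>\<O> - {0}. \<exists>b'\<in>\<O> - {0}. a / b = a' / b' \<and>
      k = int (int_ord K P a') - int (int_ord K P b')"
  then obtain c d where cd: "c \<in> \<O>" "c \<noteq> 0" "d \<in> \<O>" "d \<noteq> 0" "a / b = c / d"
    "k = int (int_ord K P c) - int (int_ord K P d)" by blast
  have "a * d = c * b" using cd assms by (simp add: field_simps)
  then have "int_ord K P a + int_ord K P d = int_ord K P c + int_ord K P b"
    using assms cd int_ord_mult by metis
  then show "k = int (int_ord K P a) - int (int_ord K P b)" using cd by simp
qed

lemma field_ord_ints: "a \<in> \<O> \<Longrightarrow> a \<noteq> 0 \<Longrightarrow> field_ord K P a = int (int_ord K P a)"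
proof -
  assume "a \<in> \<O>" "a \<noteq> 0"
  moreover have "int_ord K P 1 = 0"
    using int_ord_eqI[of 1 0] ints_one one_notin_P by (simp add: exact_order_def)
  ultimately show ?thesis using field_ord_divide_ints[of a 1] ints_one by simp
qed

lemma nonzero_quotientE:
  assumes "x \<in> K" "x \<noteq> 0"
  obtains a b where "a \<in> \<O>" "a \<noteq> 0" "b \<in> \<O>" "b \<noteq> 0" "x = a / b"
proof -
  obtain a and m :: int where "a \<in> \<O>" "m \<noteq> 0" "x = a / of_int m"
    using K_eq_int_quotient[OF assms(1)] .
  then show ?thesis using that[of a "of_int m"] ints_of_int assms(2) by auto
qed

lemma field_ord_mult:
  assumes "x \<in> K" "x \<noteq> 0" "y \<in> K" "y \<noteq> 0"
  shows "field_ord K P (x * y) = field_ord K P x + field_ord K P y"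
proof -
  obtain a b where ab: "a \<in> \<O>" "a \<noteq> 0" "b \<in> \<O>" "b \<noteq> 0" "x = a / b"
    using nonzero_quotientE[OF assms(1,2)] .
  obtain c d where cd: "c \<in> \<O>" "c \<noteq> 0" "d \<in> \<O>" "d \<noteq> 0" "y = c / d"
    using nonzero_quotientE[OF assms(3,4)] .
  have "field_ord K P (x * y) = field_ord K P ((a * c) / (b * d))" by (simp add: ab cd)
  also have "\<dots> = int (int_ord K P (a * c)) - int (int_ord K P (b * d))"
    using ab cd ints_mult by (intro field_ord_divide_ints) auto
  also have "\<dots> = field_ord K P x + field_ord K P y"
    using ab cd by (simp add: int_ord_mult field_ord_divide_ints)
  finally show ?thesis .
qed

lemma field_ord_one: "field_ord K P 1 = 0"
  using field_ord_mult[of 1 1] K_closed by simp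

lemma field_ord_power: "x \<in> K \<Longrightarrow> x \<noteq> 0 \<Longrightarrow> field_ord K P (x ^ n) = int n * field_ord K P x"
  by (induction n) (simp_all add: field_ord_one field_ord_mult K_power algebra_simps)

lemma field_ord_minus: "x \<in> K \<Longrightarrow> x \<noteq> 0 \<Longrightarrow> field_ord K P (- x) = field_ord K P x"
proof -
  assume x: "x \<in> K" "x \<noteq> 0"
  have "field_ord K P (- 1) = 0"
    using field_ord_mult[of "- 1" "- 1"] K_closed field_ord_one by auto
  then show ?thesis using field_ord_mult[of "- 1" x] x K_closed by auto
qed

lemma field_ord_add:
  assumes "x \<in> K" "x \<noteq> 0" "y \<in> K" "y \<noteq> 0" "x + y \<noteq> 0"
  shows "min (field_ord K P x) (field_ord K P y) \<le> field_ord K P (x + y)"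
proof -
  obtain a b where ab: "a \<in> \<O>" "a \<noteq> 0" "b \<in> \<O>" "b \<noteq> 0" "x = a / b"
    using nonzero_quotientE[OF assms(1,2)] .
  obtain c d where cd: "c \<in> \<O>" "c \<noteq> 0" "d \<in> \<O>" "d \<noteq> 0" "y = c / d"
    using nonzero_quotientE[OF assms(3,4)] .
  have x: "x = (a * d) / (b * d)" and y: "y = (c * b) / (b * d)" using ab cd by auto
  have xy: "x + y = (a * d + c * b) / (b * d)" unfolding x y by (simp add: add_divide_distrib)
  have nz: "a * d + c * b \<noteq> 0" using xy assms(5) by auto
  have O: "a * d \<in> \<O>" "c * b \<in> \<O>" "b * d \<in> \<O>" "a * d + c * b \<in> \<O>"
    using ab cd by (auto intro: ints_intros)
  have "min (int_ord K P (a * d)) (int_ord K P (c * b)) \<le> int_ord K P (a * d + c * b)"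
    using O nz ab cd by (intro int_ord_add) auto
  moreover have "field_ord K P x = int (int_ord K P (a * d)) - int (int_ord K P (b * d))"
    unfolding x using O ab cd by (intro field_ord_divide_ints) auto
  moreover have "field_ord K P y = int (int_ord K P (c * b)) - int (int_ord K P (b * d))"
    unfolding y using O ab cd by (intro field_ord_divide_ints) auto
  moreover have "field_ord K P (x + y) = int (int_ord K P (a * d + c * b)) - int (int_ord K P (b * d))"
    unfolding xy using O nz ab cd by (intro field_ord_divide_ints) auto
  ultimately show ?thesis by auto
qed

lemma field_ord_eq_0: "s \<in> \<O> \<Longrightarrow> s \<notin> P \<Longrightarrow> field_ord K P s = 0"
  using field_ord_ints[of s] int_ord_eqI[of s 0] P_closed(2) by (auto simp: exact_order_def)

lemma field_ord_q_pos: "field_ord K P (of_nat q) > 0"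
proof -
  have "of_nat q \<in> P_pow 1" using P_pow_mult[of 1 0 "of_nat q"] q_in_P by (simp add: P_pow_0 ints_one)
  then show ?thesis
    using P_pow_iff_int_ord[OF ints_of_nat q_nonzero, of 1] field_ord_ints[OF ints_of_nat q_nonzero]
    by simp
qed

end

section \<open>Extension of valuations\<close>

lemma
  assumes K: "number_field K" "P \<in> nonzero_primes K"
    and L: "number_field L" "Q \<in> nonzero_primes L"
    and KL: "K \<subseteq> L" and over: "Q \<inter> carrier (ring_of_integers K) = P"
  shows prime_below_extension: "prime_below Q = prime_below P"
    and valuation_extension: "x \<in> K \<Longrightarrow> x \<noteq> 0 \<Longrightarrow> valuation L Q x = valuation K P x"
proof -
  interpret K: number_field_prime K P by unfold_locales (use K in auto)
  interpret L: number_field_prime L Q by unfold_locales (use L in auto)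
  show below: "prime_below Q = prime_below P"
    using K.prime_q K.q_in_P over by (intro L.prime_below_eqI) auto
  define e where "e = - field_ord L Q K.local_inverse"
  have ints: "field_ord L Q a = e * field_ord K P a" if a: "a \<in> K.ints" "a \<noteq> 0" for a
  proof -
    define n where "n = int_ord K P a"
    define s where "s = K.local_inverse ^ n * a"
    have "s \<in> K.ints" "s \<notin> P"
      using K.exact_order_int_ord[OF a] by (auto simp: K.exact_order_def s_def n_def)
    then have "s \<in> L.ints" "s \<notin> Q"
      using KL over by (auto simp: K.ints_iff L.ints_iff)
    then have "field_ord L Q s = 0" by (rule L.field_ord_eq_0)
    moreover have "field_ord L Q s = int n * field_ord L Q K.local_inverse + field_ord L Q a"
      unfolding s_def using a K.gamma_in_K K.gamma_nonzero KL
      by (subst L.field_ord_mult) (auto simp: L.field_ord_power L.K_power K.ints_iff)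
    ultimately show ?thesis by (simp add: K.field_ord_ints[OF a] e_def n_def algebra_simps)
  qed
  have fo: "field_ord L Q x = e * field_ord K P x" if x: "x \<in> K" "x \<noteq> 0" for x
  proof -
    obtain a b where ab: "a \<in> K.ints" "a \<noteq> 0" "b \<in> K.ints" "b \<noteq> 0" "x = a / b"
      using K.nonzero_quotientE[OF x] .
    have a: "a = x * b" using ab by simp
    have "b \<in> K" using ab by (simp add: K.ints_iff)
    then have "field_ord L Q (x * b) = field_ord L Q x + field_ord L Q b"
      "field_ord K P (x * b) = field_ord K P x + field_ord K P b"
      using x ab(4) KL L.field_ord_mult[of x b] K.field_ord_mult[of x b] by blast+
    then show ?thesis
      using ints[OF ab(1,2)] ints[OF ab(3,4)] unfolding a[symmetric] by (simp add: algebra_simps)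
  qed
  have q: "field_ord L Q (of_nat (prime_below P)) = e * field_ord K P (of_nat (prime_below P))"
    using fo K.K_of_nat K.q_nonzero by blast
  then have "e \<noteq> 0" using L.field_ord_q_pos below by auto
  then show "valuation L Q x = valuation K P x" if "x \<in> K" "x \<noteq> 0"
    unfolding valuation_def below q fo[OF that] by simp
qed

lemma arith_partial_deriv_eq:
  assumes K: "number_field K" "P \<in> nonzero_primes K"
    and ex: "\<exists>L. K \<subseteq> L \<and> galois_number_field L"
  shows "\<exists>r. \<forall>x\<in>K - {0}. arith_partial_deriv K P x = x * of_rat (valuation K P x * r)"
proof -
  define L where "L = galois_extension K"
  have "K \<subseteq> L \<and> galois_number_field L"
    unfolding L_def galois_extension_def using ex by (rule someI_ex)
  then have KL: "K \<subseteq> L" and L: "number_field L" by (auto simp: galois_number_field_def)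
  define T where "T = primes_over L K {P}"
  define r :: rat where
    "r = of_nat (card T) / of_nat (prime_below P * num_primes_over (prime_below P) L)"
  have "arith_partial_deriv K P x = x * of_rat (valuation K P x * r)" if x: "x \<in> K" "x \<noteq> 0" for x
  proof -
    have val: "valuation L Q x = valuation K P x" and below: "prime_below Q = prime_below P"
      if "Q \<in> T" for Q
    proof -
      have "Q \<in> nonzero_primes L" "Q \<inter> carrier (ring_of_integers K) = P"
        using that by (auto simp: T_def primes_over_def)
      then show "valuation L Q x = valuation K P x" "prime_below Q = prime_below P"
        using valuation_extension[OF K L _ KL] prime_below_extension[OF K L _ KL] x by auto
    qed
    let ?S = "{Q \<in> T. valuation L Q x \<noteq> 0}"
    have "(\<Sum>Q\<in>?S. valuation L Q x / of_nat (prime_below Q * num_primes_over (prime_below Q) L)) =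
        (\<Sum>Q\<in>?S. valuation K P x / of_nat (prime_below P * num_primes_over (prime_below P) L))"
      by (intro sum.cong) (auto simp: val below)
    also have "\<dots> = valuation K P x * r"
    proof (cases "valuation K P x = 0")
      case False
      then have "?S = T" using val by auto
      then show ?thesis by (simp add: r_def)
    qed simp
    finally show ?thesis
      using x unfolding arith_partial_deriv_def arith_deriv_def arith_deriv_galois_def
      by (simp flip: L_def T_def)
  qed
  then show ?thesis by blast
qed

section \<open>The topology at a prime ideal\<close>

context number_field_prime
begin

lemma valuation_mult:
  "x \<in> K \<Longrightarrow> x \<noteq> 0 \<Longrightarrow> y \<in> K \<Longrightarrow> y \<noteq> 0 \<Longrightarrow>
    valuation K P (x * y) = valuation K P x + valuation K P y"
  by (simp add: valuation_def field_ord_mult add_divide_distrib)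

lemma field_ord_outside:
  assumes "x \<notin> K"
  shows "field_ord K P x = (THE k. False)"
proof -
  have "x \<noteq> a / b" if "a \<in> \<O>" "b \<in> \<O>" for a b
    using assms that K_divide[of a b] by (auto simp: ints_iff)
  then show ?thesis unfolding field_ord_def by (intro arg_cong[of _ _ The]) blast
qed

text \<open>
  The distance of \<^locale>\<open>Metric_space\<close> must be symmetric outside the carrier, too; there the
  junk values of \<^const>\<open>field_ord\<close> agree.
\<close>
lemma valuation_minus: "x \<noteq> 0 \<Longrightarrow> valuation K P (- x) = valuation K P x"
  using field_ord_minus[of x] field_ord_outside[of x] field_ord_outside[of "- x"] K_closed(5)[of "- x"]
  by (cases "x \<in> K") (auto simp: valuation_def)

lemma valuation_add:
  assumes "x \<in> K" "x \<noteq> 0" "y \<in> K" "y \<noteq> 0" "x + y \<noteq> 0"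
  shows "min (valuation K P x) (valuation K P y) \<le> valuation K P (x + y)"
proof -
  have "field_ord K P x \<le> field_ord K P (x + y) \<or> field_ord K P y \<le> field_ord K P (x + y)"
    using field_ord_add[OF assms] by linarith
  then show ?thesis
    using field_ord_q_pos by (auto simp: valuation_def min_le_iff_disj divide_right_mono)
qed

lemma valuation_ints_nonneg: "a \<in> \<O> \<Longrightarrow> a \<noteq> 0 \<Longrightarrow> valuation K P a \<ge> 0"
  using field_ord_q_pos by (simp add: valuation_def field_ord_ints)

context
  fixes c :: real
  assumes c: "0 < c" "c < 1"
begin

abbreviation padic_norm :: "'a \<Rightarrow> real" ("\<parallel>_\<parallel>") where
  "\<parallel>x\<parallel> \<equiv> padic_abs c K P x"

lemma padic_abs_nonneg: "\<parallel>x\<parallel> \<ge> 0"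
  by (simp add: padic_abs_def)

lemma padic_abs_eq_0_iff: "\<parallel>x\<parallel> = 0 \<longleftrightarrow> x = 0"
  using c by (simp add: padic_abs_def)

lemma padic_abs_mult: "x \<in> K \<Longrightarrow> y \<in> K \<Longrightarrow> \<parallel>x * y\<parallel> = \<parallel>x\<parallel> * \<parallel>y\<parallel>"
  by (simp add: padic_abs_def valuation_mult of_rat_add powr_add)

lemma padic_abs_minus: "\<parallel>- x\<parallel> = \<parallel>x\<parallel>"
  by (simp add: padic_abs_def valuation_minus)

lemma padic_abs_le_iff:
  assumes "x \<noteq> 0" "y \<noteq> 0"
  shows "\<parallel>x\<parallel> \<le> \<parallel>y\<parallel> \<longleftrightarrow> valuation K P y \<le> valuation K P x"
proof -
  have "ln c < 0" using c by simp
  then show ?thesis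
    using c assms by (simp add: padic_abs_def powr_def mult_le_cancel_right of_rat_less_eq)
qed

lemma padic_abs_add:
  assumes "x \<in> K" "y \<in> K"
  shows "\<parallel>x + y\<parallel> \<le> max \<parallel>x\<parallel> \<parallel>y\<parallel>"
proof (cases "x = 0 \<or> y = 0 \<or> x + y = 0")
  case True
  then show ?thesis
    using padic_abs_nonneg[of x] padic_abs_nonneg[of y] padic_abs_eq_0_iff[of 0]
    by (auto simp: le_max_iff_disj)
next
  case False
  then show ?thesis
    using valuation_add[of x y] assms by (auto simp: le_max_iff_disj padic_abs_le_iff min_le_iff_disj)
qed

lemma padic_abs_ints: "a \<in> \<O> \<Longrightarrow> \<parallel>a\<parallel> \<le> 1"
  using valuation_ints_nonneg[of a] c by (auto simp: padic_abs_def powr_le1)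

lemma Metric_space_padic: "Metric_space K (\<lambda>x y. \<parallel>x - y\<parallel>)"
proof
  fix x y z assume xyz: "x \<in> K" "y \<in> K" "z \<in> K"
  show "\<parallel>x - y\<parallel> = 0 \<longleftrightarrow> x = y" by (simp add: padic_abs_eq_0_iff)
  have "\<parallel>x - z\<parallel> \<le> max \<parallel>x - y\<parallel> \<parallel>y - z\<parallel>"
    using padic_abs_add[of "x - y" "y - z"] xyz K_diff by simp
  then show "\<parallel>x - z\<parallel> \<le> \<parallel>x - y\<parallel> + \<parallel>y - z\<parallel>"
    using padic_abs_nonneg[of "x - y"] padic_abs_nonneg[of "y - z"] by linarith
next
  fix x y
  show "\<parallel>x - y\<parallel> \<ge> 0" by (rule padic_abs_nonneg)
  show "\<parallel>x - y\<parallel> = \<parallel>y - x\<parallel>" using padic_abs_minus[of "x - y"] by simp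
qed

interpretation padic: Metric_space K "\<lambda>x y. \<parallel>x - y\<parallel>"
  by (rule Metric_space_padic)

lemma padic_topcontinuous_at_if_locally_Lipschitz:
  assumes x: "x \<in> K" and f: "f \<in> K \<rightarrow> K" and "\<delta> > 0"
    and Lip: "\<And>y. y \<in> K \<Longrightarrow> \<parallel>x - y\<parallel> < \<delta> \<Longrightarrow> \<parallel>f x - f y\<parallel> \<le> C * \<parallel>x - y\<parallel>"
  shows "topcontinuous_at (padic_topology c K P) (padic_topology c K P) f x"
  unfolding topcontinuous_at_def padic_topology_def padic.topspace_mtopology
proof (intro conjI allI impI)
  fix V assume V: "openin padic.mtopology V \<and> f x \<in> V"
  then obtain \<epsilon> where e: "\<epsilon> > 0" "padic.mball (f x) \<epsilon> \<subseteq> V"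
    unfolding padic.openin_mtopology by blast
  define M where "M = max C 1"
  have M: "M > 0" "C \<le> M" by (auto simp: M_def)
  define \<eta> where "\<eta> = min \<delta> (\<epsilon> / M)"
  have "\<eta> > 0" using M e \<open>\<delta> > 0\<close> by (simp add: \<eta>_def)
  moreover have "f y \<in> V" if y: "y \<in> padic.mball x \<eta>" for y
  proof -
    have "y \<in> K" "\<parallel>x - y\<parallel> < \<delta>" "\<parallel>x - y\<parallel> < \<epsilon> / M" using y by (auto simp: \<eta>_def)
    then have "\<parallel>f x - f y\<parallel> \<le> C * \<parallel>x - y\<parallel>" by (intro Lip)
    also have "\<dots> \<le> M * \<parallel>x - y\<parallel>" using M padic_abs_nonneg by (intro mult_right_mono)
    also have "\<dots> < \<epsilon>" using \<open>\<parallel>x - y\<parallel> < \<epsilon> / M\<close> M by (simp add: field_simps)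
    finally have "f y \<in> padic.mball (f x) \<epsilon>" using x f \<open>y \<in> K\<close> by (auto simp: Pi_iff)
    then show ?thesis using e(2) by blast
  qed
  ultimately show "\<exists>U. openin padic.mtopology U \<and> x \<in> U \<and> (\<forall>y\<in>U. f y \<in> V)"
    using x padic_abs_eq_0_iff[of 0] by (intro exI[of _ "padic.mball x \<eta>"]) auto
qed (use x f in auto)

lemma padic_continuous_if_times_valuation:
  assumes f0: "f 0 = 0" and f: "\<And>x. x \<in> K \<Longrightarrow> x \<noteq> 0 \<Longrightarrow> f x = x * of_rat (valuation K P x * r)"
    and x: "x \<in> K"
  shows "topcontinuous_at (padic_topology c K P) (padic_topology c K P) f x"
proof -
  have fK: "f \<in> K \<rightarrow> K"
  proof
    fix y assume "y \<in> K"
    then show "f y \<in> K" using f0 f[of y] K_closed K_of_rat by (cases "y = 0") auto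
  qed
  show ?thesis
  proof (cases "x = 0")
    case True
    define C where "C = \<parallel>of_rat (r / of_int (field_ord K P (of_nat q)))\<parallel>"
    have bound: "\<parallel>f y\<parallel> \<le> C * \<parallel>y\<parallel>" if y: "y \<in> K" for y
    proof (cases "y = 0")
      case False
      define k where "k = field_ord K P y"
      have "f y = of_rat (r / of_int (field_ord K P (of_nat q))) * (of_int k * y)"
        using f[OF y False] by (simp add: valuation_def k_def of_rat_mult of_rat_divide)
      then have "\<parallel>f y\<parallel> = C * (\<parallel>of_int k\<parallel> * \<parallel>y\<parallel>)"
        using y K_closed K_of_int K_of_rat by (simp add: padic_abs_mult C_def)
      also have "\<dots> \<le> C * (1 * \<parallel>y\<parallel>)"
        using padic_abs_ints[OF ints_of_int] padic_abs_nonneg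
        by (intro mult_left_mono mult_right_mono) (auto simp: C_def)
      finally show ?thesis by simp
    qed (simp add: f0 padic_abs_def)
    show ?thesis
      by (rule padic_topcontinuous_at_if_locally_Lipschitz[OF x fK, of 1 C])
        (use bound in \<open>auto simp: True f0 padic_abs_minus\<close>)
  next
    case False
    define a where "a = (of_rat (valuation K P x * r) :: 'a)"
    have "\<parallel>f x - f y\<parallel> \<le> \<parallel>a\<parallel> * \<parallel>x - y\<parallel>" if y: "y \<in> K" "\<parallel>x - y\<parallel> < \<parallel>x\<parallel>" for y
    proof -
      have "y \<noteq> 0" using y by auto
      have "\<parallel>x\<parallel> \<le> max \<parallel>x - y\<parallel> \<parallel>y\<parallel>" using padic_abs_add[of "x - y" y] x y K_diff by simp
      then have "\<parallel>x\<parallel> \<le> \<parallel>y\<parallel>" using y by auto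
      moreover have "\<parallel>y\<parallel> \<le> max \<parallel>y - x\<parallel> \<parallel>x\<parallel>" using padic_abs_add[of "y - x" x] x y K_diff by simp
      then have "\<parallel>y\<parallel> \<le> \<parallel>x\<parallel>" using y padic_abs_minus[of "x - y"] by auto
      ultimately have "valuation K P y = valuation K P x"
        using padic_abs_le_iff False \<open>y \<noteq> 0\<close> by (intro antisym) auto
      then have "f x - f y = a * (x - y)"
        using f[OF x False] f[OF y(1) \<open>y \<noteq> 0\<close>] by (simp add: a_def algebra_simps)
      then show ?thesis using padic_abs_mult[of a "x - y"] x y K_diff K_of_rat by (simp add: a_def)
    qed
    moreover have "\<parallel>x\<parallel> > 0" using False padic_abs_nonneg[of x] padic_abs_eq_0_iff[of x] by simp
    ultimately show ?thesis
      by (intro padic_topcontinuous_at_if_locally_Lipschitz[OF x fK]) auto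
  qed
qed

end

end

theorem theorem5p2:
  fixes K :: "'a::{alg_closed_field, field_char_0} set" and P :: "'a set" and c :: real
  assumes "number_field K"
    and "primeideal P (ring_of_integers K)" and "P \<noteq> {0}"
    and "0 < c" and "c < 1"
  shows "\<forall>x\<in>K. topcontinuous_at (padic_topology c K P) (padic_topology c K P)
           (arith_partial_deriv K P) x"
proof
  fix x assume x: "x \<in> K"
  have P: "P \<in> nonzero_primes K" using assms(2,3) by (simp add: nonzero_primes_def)
  interpret number_field_prime K P by unfold_locales (use assms(1) P in auto)
  obtain r where "\<And>x. x \<in> K \<Longrightarrow> x \<noteq> 0 \<Longrightarrow> arith_partial_deriv K P x = x * of_rat (valuation K P x * r)"
    using arith_partial_deriv_eq[OF assms(1) P ex_galois_extension[OF assms(1)]] by blast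
  moreover have "arith_partial_deriv K P 0 = 0"
    by (simp add: arith_partial_deriv_def arith_deriv_def arith_deriv_galois_def)
  ultimately show "topcontinuous_at (padic_topology c K P) (padic_topology c K P)
      (arith_partial_deriv K P) x"
    by (intro padic_continuous_if_times_valuation[OF assms(4,5)] x)
qed

end
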